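(* Let $H$ be a commutative Hopf algebra and let $A(B)^H$ be a Hopf Galois extension. Then the map $$\kappa\colon H\to (A\otimes_B A)^B,\qquad \kappa(h)=can^{-1}(1_A\otimes h),$$ is a convolution invertible total integral.
   Context: All Hopf algebras, algebras and coalgebras are over a field; every Hopf algebra $H$ has an invertible antipode. Sweedler notation: $\Delta(h)=h^{(1)}\otimes h^{(2)}$; right coactions are $a\mapsto a_{\langle 0\rangle}\otimes a_{\langle 1\rangle}$. For a right $H$-comodule algebra $A$ with coinvariants $B=\{a\in A: a_{\langle 0\rangle}\otimes a_{\langle 1\rangle}=a\otimes 1_H\}$, the extension $A(B)^H$ is (right) Hopf Galois if $can\colon A\otimes_B A\to A\otimes H$, $a\otimes a'\mapsto aa'_{\langle 0\rangle}\otimes a'_{\langle 1\rangle}$, is bijective. Here $(A\otimes_B A)^B$ is the set of elements $\sum a\otimes a'\in A\otimes_B A$ with $\sum ba\otimes a'=\sum a\otimes a'b$ for all $b\in B$; it is an algebra with product $(a_1\otimes a_1')(a_2\otimes a_2')=a_1a_2\otimes a_2'a_1'$, and for $H$ commutative it is a right $H$-comodule algebra by $a\otimes_B a'\mapsto (a\otimes_B a'_{\langle 0\rangle})\otimes a'_{\langle 1\rangle}$. For a right $H$-comodule algebra $E$, a total integral $f\colon H\to E$ is a linear map with $f(1)=1$ and $f(h^{(1)})\otimes h^{(2)}=f(h)_{\langle 0\rangle}\otimes f(h)_{\langle 1\rangle}$; it is convolution invertible if it is invertible in the convolution algebra $\mathrm{Hom}(H,E)$. *)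

theory Defs
  imports "HOL-Algebra.Free_Abelian_Groups" "HOL-Algebra.Module"
begin

section \<open>Balanced tensor products of abelian groups\<close>

text \<open>
  \<open>M\<close> and \<open>N\<close> are abelian groups (the additive parts of ring records) on which a set \<open>S\<close> of
  scalars acts, on \<open>M\<close> from the right by \<open>r\<close> and on \<open>N\<close> from the left by \<open>l\<close>.  Their tensor
  product is the free abelian group on the pairs modulo biadditivity and
  \<open>(m \<cdot> s, n) \<sim> (m, s \<cdot> n)\<close>.  Two instances are used below: the tensor product over the ground
  field, and the tensor product over the subalgebra of coinvariants.
\<close>

definition tensor_relations ::
  "('a, 'm) ring_scheme \<Rightarrow> ('b, 'n) ring_scheme \<Rightarrow> 's set \<Rightarrow> ('a \<Rightarrow> 's \<Rightarrow> 'a) \<Rightarrow> ('s \<Rightarrow> 'b \<Rightarrow> 'b)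
    \<Rightarrow> ('a \<times> 'b \<Rightarrow>\<^sub>0 int) set" where
  "tensor_relations M N S r l =
     {frag_of (m \<oplus>\<^bsub>M\<^esub> m', n) - (frag_of (m, n) + frag_of (m', n)) | m m' n.
        m \<in> carrier M \<and> m' \<in> carrier M \<and> n \<in> carrier N}
   \<union> {frag_of (m, n \<oplus>\<^bsub>N\<^esub> n') - (frag_of (m, n) + frag_of (m, n')) | m n n'.
        m \<in> carrier M \<and> n \<in> carrier N \<and> n' \<in> carrier N}
   \<union> {frag_of (r m s, n) - frag_of (m, l s n) | m s n.
        m \<in> carrier M \<and> s \<in> S \<and> n \<in> carrier N}"

definition tensor_null ::
  "('a, 'm) ring_scheme \<Rightarrow> ('b, 'n) ring_scheme \<Rightarrow> 's set \<Rightarrow> ('a \<Rightarrow> 's \<Rightarrow> 'a) \<Rightarrow> ('s \<Rightarrow> 'b \<Rightarrow> 'b)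
    \<Rightarrow> ('a \<times> 'b \<Rightarrow>\<^sub>0 int) set" where
  "tensor_null M N S r l =
     generate (free_Abelian_group (carrier M \<times> carrier N)) (tensor_relations M N S r l)"

definition tensor_group ::
  "('a, 'm) ring_scheme \<Rightarrow> ('b, 'n) ring_scheme \<Rightarrow> 's set \<Rightarrow> ('a \<Rightarrow> 's \<Rightarrow> 'a) \<Rightarrow> ('s \<Rightarrow> 'b \<Rightarrow> 'b)
    \<Rightarrow> ('a \<times> 'b \<Rightarrow>\<^sub>0 int) set monoid" where
  "tensor_group M N S r l =
     free_Abelian_group (carrier M \<times> carrier N) Mod tensor_null M N S r l"

definition tensor_coset ::
  "('a, 'm) ring_scheme \<Rightarrow> ('b, 'n) ring_scheme \<Rightarrow> 's set \<Rightarrow> ('a \<Rightarrow> 's \<Rightarrow> 'a) \<Rightarrow> ('s \<Rightarrow> 'b \<Rightarrow> 'b)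
    \<Rightarrow> 'a \<Rightarrow> 'b \<Rightarrow> ('a \<times> 'b \<Rightarrow>\<^sub>0 int) set" where
  "tensor_coset M N S r l m n =
     tensor_null M N S r l #>\<^bsub>free_Abelian_group (carrier M \<times> carrier N)\<^esub> frag_of (m, n)"

text \<open>
  \<open>tensor_lift G \<psi>\<close> is the homomorphism \<open>\<Sum> m \<otimes> n \<mapsto> \<Sum> \<psi> m n\<close> into the commutative group \<open>G\<close>
  (written multiplicatively) induced by a biadditive balanced map \<open>\<psi>\<close>.  Being defined on cosets,
  it is meaningful only for such \<open>\<psi>\<close>; see \<open>tensor_lift_coset\<close> and \<open>tensor_lift_hom\<close> below.
  Since \<open>\<Delta> h\<close> is a sum \<open>\<Sum> h\<^sub>1 \<otimes> h\<^sub>2\<close>, the Sweedler expression \<open>\<psi> h\<^sub>1 h\<^sub>2\<close> is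
  \<open>tensor_lift G \<psi> (\<Delta> h)\<close>.
\<close>

definition frag_eval :: "('c, 'g) monoid_scheme \<Rightarrow> ('a \<Rightarrow> 'b \<Rightarrow> 'c) \<Rightarrow> ('a \<times> 'b \<Rightarrow>\<^sub>0 int) \<Rightarrow> 'c" where
  "frag_eval G \<psi> x =
     finprod G (\<lambda>p. \<psi> (fst p) (snd p) [^]\<^bsub>G\<^esub> Poly_Mapping.lookup x p) (Poly_Mapping.keys x)"

definition tensor_lift ::
  "('c, 'g) monoid_scheme \<Rightarrow> ('a \<Rightarrow> 'b \<Rightarrow> 'c) \<Rightarrow> ('a \<times> 'b \<Rightarrow>\<^sub>0 int) set \<Rightarrow> 'c" where
  "tensor_lift G \<psi> X = the_elem (frag_eval G \<psi> ` X)"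

definition balanced_map ::
  "('a, 'm) ring_scheme \<Rightarrow> ('b, 'n) ring_scheme \<Rightarrow> 's set \<Rightarrow> ('a \<Rightarrow> 's \<Rightarrow> 'a) \<Rightarrow> ('s \<Rightarrow> 'b \<Rightarrow> 'b)
    \<Rightarrow> ('c, 'g) monoid_scheme \<Rightarrow> ('a \<Rightarrow> 'b \<Rightarrow> 'c) \<Rightarrow> bool" where
  "balanced_map M N S r l G \<psi> \<longleftrightarrow>
     (\<forall>m\<in>carrier M. \<forall>n\<in>carrier N. \<psi> m n \<in> carrier G)
   \<and> (\<forall>m\<in>carrier M. \<forall>m'\<in>carrier M. \<forall>n\<in>carrier N. \<psi> (m \<oplus>\<^bsub>M\<^esub> m') n = \<psi> m n \<otimes>\<^bsub>G\<^esub> \<psi> m' n)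
   \<and> (\<forall>m\<in>carrier M. \<forall>n\<in>carrier N. \<forall>n'\<in>carrier N. \<psi> m (n \<oplus>\<^bsub>N\<^esub> n') = \<psi> m n \<otimes>\<^bsub>G\<^esub> \<psi> m n')
   \<and> (\<forall>m\<in>carrier M. \<forall>s\<in>S. \<forall>n\<in>carrier N. \<psi> (r m s) n = \<psi> m (l s n))"

locale tensor_setup =
  fixes M :: "('a, 'm) ring_scheme" and N :: "('b, 'n) ring_scheme"
    and S :: "'s set" and r :: "'a \<Rightarrow> 's \<Rightarrow> 'a" and l :: "'s \<Rightarrow> 'b \<Rightarrow> 'b"
  assumes abM: "abelian_group M" and abN: "abelian_group N"
    and r_closed: "\<And>m s. m \<in> carrier M \<Longrightarrow> s \<in> S \<Longrightarrow> r m s \<in> carrier M"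
    and l_closed: "\<And>s n. s \<in> S \<Longrightarrow> n \<in> carrier N \<Longrightarrow> l s n \<in> carrier N"
begin

abbreviation "F \<equiv> free_Abelian_group (carrier M \<times> carrier N)"
abbreviation "Z \<equiv> tensor_null M N S r l"

lemma relations_carrier: "tensor_relations M N S r l \<subseteq> carrier F"
proof -
  interpret M: abelian_group M by (rule abM)
  interpret N: abelian_group N by (rule abN)
  have d: "a - b \<in> carrier F" if "a \<in> carrier F" "b \<in> carrier F" for a b
    using that keys_diff[of a b] by auto
  have s: "a + b \<in> carrier F" if "a \<in> carrier F" "b \<in> carrier F" for a b
    using that keys_add[of a b] by auto
  have g: "frag_of (m, n) \<in> carrier F" if "m \<in> carrier M" "n \<in> carrier N" for m n
    using that by simp
  show ?thesis
    unfolding tensor_relations_def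
    by (auto simp del: carrier_free_Abelian_group_iff intro!: d s g r_closed l_closed)
qed

lemma normal_Z: "Z \<lhd> F"
  unfolding tensor_null_def
  by (intro comm_group.subgroup_imp_normal abelian_free_Abelian_group
        group.generate_is_subgroup group_free_Abelian_group relations_carrier)

lemma comm_group_tensor_group: "comm_group (tensor_group M N S r l)"
  unfolding tensor_group_def
  by (intro comm_group.abelian_FactGroup abelian_free_Abelian_group normal_imp_subgroup normal_Z)

lemma frag_eval_hom:
  assumes G: "comm_group G" and b: "balanced_map M N S r l G \<psi>"
  shows "frag_eval G \<psi> \<in> hom F G"
    and "m \<in> carrier M \<Longrightarrow> n \<in> carrier N \<Longrightarrow> frag_eval G \<psi> (frag_of (m, n)) = \<psi> m n"
proof -
  interpret G: comm_group G by (rule G)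
  have c: "\<psi> (fst p) (snd p) \<in> carrier G" if "p \<in> carrier M \<times> carrier N" for p
    using b that by (auto simp: balanced_map_def)
  have ext: "frag_eval G \<psi> x =
      finprod G (\<lambda>p. \<psi> (fst p) (snd p) [^]\<^bsub>G\<^esub> Poly_Mapping.lookup x p) A"
    if "finite A" "Poly_Mapping.keys x \<subseteq> A" "A \<subseteq> carrier M \<times> carrier N" for x A
    unfolding frag_eval_def
    by (rule G.finprod_mono_neutral_cong_left)
       (use that c in \<open>auto simp: not_in_keys_iff_lookup_eq_zero\<close>)
  show "frag_eval G \<psi> \<in> hom F G"
  proof (rule homI)
    fix x assume x: "x \<in> carrier F"
    then show "frag_eval G \<psi> x \<in> carrier G"
      unfolding frag_eval_def using c by (intro G.finprod_closed) auto
  next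
    fix x y assume xy: "x \<in> carrier F" "y \<in> carrier F"
    let ?A = "Poly_Mapping.keys x \<union> Poly_Mapping.keys y"
    have A: "finite ?A" "?A \<subseteq> carrier M \<times> carrier N" using xy by auto
    have cl: "(\<lambda>p. \<psi> (fst p) (snd p) [^]\<^bsub>G\<^esub> Poly_Mapping.lookup z p) \<in> ?A \<rightarrow> carrier G"
      for z :: "'a \<times> 'b \<Rightarrow>\<^sub>0 int"
      by (intro Pi_I G.int_pow_closed c subsetD[OF A(2)])
    have "frag_eval G \<psi> (x + y) =
        finprod G (\<lambda>p. \<psi> (fst p) (snd p) [^]\<^bsub>G\<^esub> Poly_Mapping.lookup (x + y) p) ?A"
      by (rule ext[OF A(1) keys_add A(2)])
    also have "\<dots> = finprod G (\<lambda>p. \<psi> (fst p) (snd p) [^]\<^bsub>G\<^esub> Poly_Mapping.lookup x p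
          \<otimes>\<^bsub>G\<^esub> \<psi> (fst p) (snd p) [^]\<^bsub>G\<^esub> Poly_Mapping.lookup y p) ?A"
      by (rule G.finprod_cong') (use A(2) c in \<open>auto simp: lookup_add G.int_pow_mult\<close>)
    also have "\<dots> = frag_eval G \<psi> x \<otimes>\<^bsub>G\<^esub> frag_eval G \<psi> y"
      by (simp add: G.finprod_multf[OF cl cl] ext[OF A(1) _ A(2)])
    finally show "frag_eval G \<psi> (x \<otimes>\<^bsub>F\<^esub> y) = frag_eval G \<psi> x \<otimes>\<^bsub>G\<^esub> frag_eval G \<psi> y"
      by simp
  qed
  show "frag_eval G \<psi> (frag_of (m, n)) = \<psi> m n" if "m \<in> carrier M" "n \<in> carrier N"
    using c[of "(m, n)"] that by (simp add: frag_eval_def G.int_pow_1)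
qed

lemma Z_subset_kernel:
  assumes G: "comm_group G" and b: "balanced_map M N S r l G \<psi>"
  shows "Z \<subseteq> kernel F G (frag_eval G \<psi>)"
proof -
  interpret G: comm_group G by (rule G)
  interpret M: abelian_group M by (rule abM)
  interpret N: abelian_group N by (rule abN)
  interpret h: group_hom F G "frag_eval G \<psi>"
    using frag_eval_hom(1)[OF G b] by (simp add: group_hom_def group_hom_axioms_def G.is_group)
  note ev = frag_eval_hom(2)[OF G b]
  have c: "\<psi> m n \<in> carrier G" if "m \<in> carrier M" "n \<in> carrier N" for m n
    using b that by (auto simp: balanced_map_def)
  have pl: "frag_eval G \<psi> (x + y) = frag_eval G \<psi> x \<otimes>\<^bsub>G\<^esub> frag_eval G \<psi> y"
    if "x \<in> carrier F" "y \<in> carrier F" for x y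
    using h.hom_mult[OF that] by simp
  have df: "frag_eval G \<psi> (x - y) = frag_eval G \<psi> x \<otimes>\<^bsub>G\<^esub> inv\<^bsub>G\<^esub> frag_eval G \<psi> y"
    if "x \<in> carrier F" "y \<in> carrier F" for x y
  proof -
    have "frag_eval G \<psi> (x + (- y)) = frag_eval G \<psi> x \<otimes>\<^bsub>G\<^esub> frag_eval G \<psi> (- y)"
      using that by (intro pl) (auto simp: keys_minus)
    also have "frag_eval G \<psi> (- y) = inv\<^bsub>G\<^esub> frag_eval G \<psi> y"
      using h.hom_inv[OF that(2)] that(2) by simp
    finally show ?thesis by simp
  qed
  have fin: "frag_of (m, n) \<in> carrier F" if "m \<in> carrier M" "n \<in> carrier N" for m n
    using that by simp
  have add: "frag_of (m, n) + frag_of (m', n') \<in> carrier F"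
    if "m \<in> carrier M" "n \<in> carrier N" "m' \<in> carrier M" "n' \<in> carrier N" for m n m' n'
    using h.G.m_closed[OF fin fin, OF that] by simp
  have z: "frag_eval G \<psi> x = \<one>\<^bsub>G\<^esub>" if "x \<in> tensor_relations M N S r l" for x
    using that b c unfolding tensor_relations_def balanced_map_def
    by (elim UnE CollectE exE conjE)
       (simp_all add: df pl ev fin add r_closed l_closed del: carrier_free_Abelian_group_iff)
  have "tensor_relations M N S r l \<subseteq> kernel F G (frag_eval G \<psi>)"
    unfolding kernel_def using z relations_carrier by blast
  then show ?thesis
    unfolding tensor_null_def
    by (rule h.G.generate_subgroup_incl[OF _ h.subgroup_kernel])
qed

lemma tensor_lift_rcos:
  assumes G: "comm_group G" and b: "balanced_map M N S r l G \<psi>" and x: "x \<in> carrier F"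
  shows "tensor_lift G \<psi> (Z #>\<^bsub>F\<^esub> x) = frag_eval G \<psi> x"
proof -
  interpret G: comm_group G by (rule G)
  interpret h: group_hom F G "frag_eval G \<psi>"
    using frag_eval_hom(1)[OF G b] by (simp add: group_hom_def group_hom_axioms_def G.is_group)
  have "frag_eval G \<psi> (z \<otimes>\<^bsub>F\<^esub> x) = frag_eval G \<psi> x" if "z \<in> Z" for z
    using Z_subset_kernel[OF G b] that x h.hom_mult[of z x] h.hom_closed[OF x]
    by (auto simp: kernel_def)
  moreover have "Z \<noteq> {}" by (auto simp: tensor_null_def intro: generate.one)
  moreover have "Z #>\<^bsub>F\<^esub> x = (\<lambda>z. z \<otimes>\<^bsub>F\<^esub> x) ` Z"
    by (auto simp: r_coset_def)
  ultimately have "frag_eval G \<psi> ` (Z #>\<^bsub>F\<^esub> x) = {frag_eval G \<psi> x}"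
    by (simp add: image_image image_constant_conv del: mult_free_Abelian_group cong: image_cong)
  then show ?thesis by (simp add: tensor_lift_def)
qed

lemma tensor_lift_coset:
  assumes "comm_group G" "balanced_map M N S r l G \<psi>" "m \<in> carrier M" "n \<in> carrier N"
  shows "tensor_lift G \<psi> (tensor_coset M N S r l m n) = \<psi> m n"
  unfolding tensor_coset_def
  using tensor_lift_rcos[OF assms(1,2)] frag_eval_hom(2)[OF assms] assms(3,4) by simp

lemma tensor_lift_hom:
  assumes G: "comm_group G" and b: "balanced_map M N S r l G \<psi>"
  shows "tensor_lift G \<psi> \<in> hom (tensor_group M N S r l) G"
proof (rule homI)
  interpret G: comm_group G by (rule G)
  interpret Z: normal Z F by (rule normal_Z)
  note h = frag_eval_hom(1)[OF G b]
  fix X assume "X \<in> carrier (tensor_group M N S r l)"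
  then obtain x where x: "x \<in> carrier F" "X = Z #>\<^bsub>F\<^esub> x"
    by (auto simp: tensor_group_def FactGroup_def RCOSETS_def)
  show "tensor_lift G \<psi> X \<in> carrier G"
    unfolding x(2) tensor_lift_rcos[OF G b x(1)] using h x(1) by (rule hom_in_carrier)
  fix Y assume "Y \<in> carrier (tensor_group M N S r l)"
  then obtain y where y: "y \<in> carrier F" "Y = Z #>\<^bsub>F\<^esub> y"
    by (auto simp: tensor_group_def FactGroup_def RCOSETS_def)
  have "X \<otimes>\<^bsub>tensor_group M N S r l\<^esub> Y = Z #>\<^bsub>F\<^esub> (x \<otimes>\<^bsub>F\<^esub> y)"
    unfolding tensor_group_def x(2) y(2) FactGroup_def
    using Z.rcos_sum[OF x(1) y(1)] by simp
  then show "tensor_lift G \<psi> (X \<otimes>\<^bsub>tensor_group M N S r l\<^esub> Y)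
      = tensor_lift G \<psi> X \<otimes>\<^bsub>G\<^esub> tensor_lift G \<psi> Y"
    using tensor_lift_rcos[OF G b] x y Z.m_closed[OF x(1) y(1)] hom_mult[OF h x(1) y(1)]
    by (simp del: mult_free_Abelian_group carrier_free_Abelian_group_iff)
qed

end


section \<open>Algebras and tensor products over the ground field\<close>

text \<open>The locale \<^locale>\<open>algebra\<close> is restricted to commutative algebras.\<close>

locale assoc_algebra = field K + module K A + ring A
  for K :: "('k, 'l) ring_scheme" and A :: "('k, 'a, 'm) module_scheme" +
  assumes smult_mult_left: "\<lbrakk>c \<in> carrier K; x \<in> carrier A; y \<in> carrier A\<rbrakk>
      \<Longrightarrow> (c \<odot>\<^bsub>A\<^esub> x) \<otimes>\<^bsub>A\<^esub> y = c \<odot>\<^bsub>A\<^esub> (x \<otimes>\<^bsub>A\<^esub> y)"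
    and smult_mult_right: "\<lbrakk>c \<in> carrier K; x \<in> carrier A; y \<in> carrier A\<rbrakk>
      \<Longrightarrow> x \<otimes>\<^bsub>A\<^esub> (c \<odot>\<^bsub>A\<^esub> y) = c \<odot>\<^bsub>A\<^esub> (x \<otimes>\<^bsub>A\<^esub> y)"

definition linear_maps ::
  "('k, 'l) ring_scheme \<Rightarrow> ('k, 'a, 'm) module_scheme \<Rightarrow> ('k, 'b, 'n) module_scheme
    \<Rightarrow> ('a \<Rightarrow> 'b) set" where
  "linear_maps K M N = {f \<in> carrier M \<rightarrow> carrier N.
     (\<forall>x\<in>carrier M. \<forall>y\<in>carrier M. f (x \<oplus>\<^bsub>M\<^esub> y) = f x \<oplus>\<^bsub>N\<^esub> f y)
   \<and> (\<forall>c\<in>carrier K. \<forall>x\<in>carrier M. f (c \<odot>\<^bsub>M\<^esub> x) = c \<odot>\<^bsub>N\<^esub> f x)}"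

definition tensor_elem ::
  "('k, 'l) ring_scheme \<Rightarrow> ('k, 'a, 'm) module_scheme \<Rightarrow> ('k, 'b, 'n) module_scheme
    \<Rightarrow> 'a \<Rightarrow> 'b \<Rightarrow> ('a \<times> 'b \<Rightarrow>\<^sub>0 int) set" where
  "tensor_elem K M N =
     tensor_coset M N (carrier K) (\<lambda>m c. c \<odot>\<^bsub>M\<^esub> m) (\<lambda>c n. c \<odot>\<^bsub>N\<^esub> n)"

text \<open>The multiplicative part of the record is meaningful only if \<open>M\<close> and \<open>N\<close> are algebras.\<close>

definition tensor ::
  "('k, 'l) ring_scheme \<Rightarrow> ('k, 'a, 'm) module_scheme \<Rightarrow> ('k, 'b, 'n) module_scheme
    \<Rightarrow> ('k, ('a \<times> 'b \<Rightarrow>\<^sub>0 int) set) module" where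
  "tensor K M N =
    (let G = tensor_group M N (carrier K) (\<lambda>m c. c \<odot>\<^bsub>M\<^esub> m) (\<lambda>c n. c \<odot>\<^bsub>N\<^esub> n);
         t = tensor_elem K M N
     in \<lparr>carrier = carrier G,
         mult = (\<lambda>X Y. tensor_lift G (\<lambda>m n.
                   tensor_lift G (\<lambda>m' n'. t (m \<otimes>\<^bsub>M\<^esub> m') (n \<otimes>\<^bsub>N\<^esub> n')) Y) X),
         one = t \<one>\<^bsub>M\<^esub> \<one>\<^bsub>N\<^esub>,
         zero = \<one>\<^bsub>G\<^esub>,
         add = (\<lambda>X Y. X \<otimes>\<^bsub>G\<^esub> Y),
         smult = (\<lambda>c. tensor_lift G (\<lambda>m n. t (c \<odot>\<^bsub>M\<^esub> m) n))\<rparr>)"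

definition tensor_map ::
  "('k, 'l) ring_scheme \<Rightarrow> ('k, 'c, 'm) module_scheme \<Rightarrow> ('k, 'd, 'n) module_scheme
    \<Rightarrow> ('a \<Rightarrow> 'c) \<Rightarrow> ('b \<Rightarrow> 'd) \<Rightarrow> ('a \<times> 'b \<Rightarrow>\<^sub>0 int) set \<Rightarrow> ('c \<times> 'd \<Rightarrow>\<^sub>0 int) set" where
  "tensor_map K M' N' f g =
     tensor_lift (add_monoid (tensor K M' N')) (\<lambda>m n. tensor_elem K M' N' (f m) (g n))"

text \<open>\<open>(X \<otimes> Y) \<otimes> Z \<rightarrow> X \<otimes> (Y \<otimes> Z)\<close>\<close>

definition tensor_assoc ::
  "('k, 'l) ring_scheme \<Rightarrow> ('k, 'a, 'm) module_scheme \<Rightarrow> ('k, 'b, 'n) module_scheme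
    \<Rightarrow> ('k, 'c, 'p) module_scheme \<Rightarrow> (('a \<times> 'b \<Rightarrow>\<^sub>0 int) set \<times> 'c \<Rightarrow>\<^sub>0 int) set
    \<Rightarrow> ('a \<times> ('b \<times> 'c \<Rightarrow>\<^sub>0 int) set \<Rightarrow>\<^sub>0 int) set" where
  "tensor_assoc K X Y Z =
     (let G = add_monoid (tensor K X (tensor K Y Z))
      in tensor_lift G (\<lambda>u z. tensor_lift G (\<lambda>x y.
           tensor_elem K X (tensor K Y Z) x (tensor_elem K Y Z y z)) u))"


section \<open>Hopf algebras and comodule algebras\<close>

locale hopf_algebra = assoc_algebra K H
  for K :: "('k, 'l) ring_scheme" and H :: "('k, 'h, 'm) module_scheme" +
  fixes \<Delta> :: "'h \<Rightarrow> ('h \<times> 'h \<Rightarrow>\<^sub>0 int) set" and \<epsilon> :: "'h \<Rightarrow> 'k" and S :: "'h \<Rightarrow> 'h"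
  assumes comult_linear: "\<Delta> \<in> linear_maps K H (tensor K H H)"
    and comult_ring_hom: "\<Delta> \<in> ring_hom H (tensor K H H)"
    and counit_linear: "\<And>c h. c \<in> carrier K \<Longrightarrow> h \<in> carrier H \<Longrightarrow> \<epsilon> (c \<odot>\<^bsub>H\<^esub> h) = c \<otimes>\<^bsub>K\<^esub> \<epsilon> h"
    and counit_ring_hom: "\<epsilon> \<in> ring_hom H K"
    and coassoc: "\<And>h. h \<in> carrier H \<Longrightarrow>
      tensor_assoc K H H H (tensor_map K (tensor K H H) H \<Delta> (\<lambda>x. x) (\<Delta> h))
        = tensor_map K H (tensor K H H) (\<lambda>x. x) \<Delta> (\<Delta> h)"
    and counit_left: "\<And>h. h \<in> carrier H \<Longrightarrow>
      tensor_lift (add_monoid H) (\<lambda>x y. \<epsilon> x \<odot>\<^bsub>H\<^esub> y) (\<Delta> h) = h"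
    and counit_right: "\<And>h. h \<in> carrier H \<Longrightarrow>
      tensor_lift (add_monoid H) (\<lambda>x y. \<epsilon> y \<odot>\<^bsub>H\<^esub> x) (\<Delta> h) = h"
    and antipode_linear: "S \<in> linear_maps K H H"
    and antipode_left: "\<And>h. h \<in> carrier H \<Longrightarrow>
      tensor_lift (add_monoid H) (\<lambda>x y. S x \<otimes>\<^bsub>H\<^esub> y) (\<Delta> h) = \<epsilon> h \<odot>\<^bsub>H\<^esub> \<one>\<^bsub>H\<^esub>"
    and antipode_right: "\<And>h. h \<in> carrier H \<Longrightarrow>
      tensor_lift (add_monoid H) (\<lambda>x y. x \<otimes>\<^bsub>H\<^esub> S y) (\<Delta> h) = \<epsilon> h \<odot>\<^bsub>H\<^esub> \<one>\<^bsub>H\<^esub>"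
    and antipode_bij: "bij_betw S (carrier H) (carrier H)"

locale comodule_algebra = hopf_algebra K H \<Delta> \<epsilon> S + A: assoc_algebra K A
  for K :: "('k, 'l) ring_scheme" and H :: "('k, 'h, 'm) module_scheme"
    and \<Delta> \<epsilon> S and A :: "('k, 'a, 'n) module_scheme" +
  fixes \<rho> :: "'a \<Rightarrow> ('a \<times> 'h \<Rightarrow>\<^sub>0 int) set"
  assumes coaction_linear: "\<rho> \<in> linear_maps K A (tensor K A H)"
    and coaction_ring_hom: "\<rho> \<in> ring_hom A (tensor K A H)"
    and coaction_coassoc: "\<And>a. a \<in> carrier A \<Longrightarrow>
      tensor_assoc K A H H (tensor_map K (tensor K A H) H \<rho> (\<lambda>x. x) (\<rho> a))
        = tensor_map K A (tensor K H H) (\<lambda>x. x) \<Delta> (\<rho> a)"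
    and coaction_counit: "\<And>a. a \<in> carrier A \<Longrightarrow>
      tensor_lift (add_monoid A) (\<lambda>x h. \<epsilon> h \<odot>\<^bsub>A\<^esub> x) (\<rho> a) = a"

definition coinvariants ::
  "('k, 'l) ring_scheme \<Rightarrow> ('k, 'h, 'm) module_scheme \<Rightarrow> ('k, 'a, 'n) module_scheme
    \<Rightarrow> ('a \<Rightarrow> ('a \<times> 'h \<Rightarrow>\<^sub>0 int) set) \<Rightarrow> 'a set" where
  "coinvariants K H A \<rho> = {a \<in> carrier A. \<rho> a = tensor_elem K A H a \<one>\<^bsub>H\<^esub>}"


section \<open>The tensor square over the coinvariants and Hopf Galois extensions\<close>

definition tensor_elem_over ::
  "'a set \<Rightarrow> ('k, 'a, 'n) module_scheme \<Rightarrow> 'a \<Rightarrow> 'a \<Rightarrow> ('a \<times> 'a \<Rightarrow>\<^sub>0 int) set" where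
  "tensor_elem_over B A = tensor_coset A A B (\<lambda>a b. a \<otimes>\<^bsub>A\<^esub> b) (\<lambda>b a. b \<otimes>\<^bsub>A\<^esub> a)"

text \<open>
  The vector space \<open>A \<otimes>\<^sub>B A\<close>.  The product
  \<open>(a\<^sub>1 \<otimes> a\<^sub>1') (a\<^sub>2 \<otimes> a\<^sub>2') = a\<^sub>1 a\<^sub>2 \<otimes> a\<^sub>2' a\<^sub>1'\<close> recorded here is independent of the
  representatives only if the right factor is \<open>B\<close>-central; it is used only on
  \<open>(A \<otimes>\<^sub>B A)\<^sup>B\<close>.
\<close>

definition tensor_over ::
  "'a set \<Rightarrow> ('k, 'a, 'n) module_scheme \<Rightarrow> ('k, ('a \<times> 'a \<Rightarrow>\<^sub>0 int) set) module" where
  "tensor_over B A =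
    (let G = tensor_group A A B (\<lambda>a b. a \<otimes>\<^bsub>A\<^esub> b) (\<lambda>b a. b \<otimes>\<^bsub>A\<^esub> a);
         t = tensor_elem_over B A
     in \<lparr>carrier = carrier G,
         mult = (\<lambda>X Y. tensor_lift G (\<lambda>a\<^sub>1 a\<^sub>1'.
                   tensor_lift G (\<lambda>a\<^sub>2 a\<^sub>2'. t (a\<^sub>1 \<otimes>\<^bsub>A\<^esub> a\<^sub>2) (a\<^sub>2' \<otimes>\<^bsub>A\<^esub> a\<^sub>1')) Y) X),
         one = t \<one>\<^bsub>A\<^esub> \<one>\<^bsub>A\<^esub>,
         zero = \<one>\<^bsub>G\<^esub>,
         add = (\<lambda>X Y. X \<otimes>\<^bsub>G\<^esub> Y),
         smult = (\<lambda>c. tensor_lift G (\<lambda>a a'. t (c \<odot>\<^bsub>A\<^esub> a) a'))\<rparr>)"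

definition tensor_centralizer ::
  "'a set \<Rightarrow> ('k, 'a, 'n) module_scheme \<Rightarrow> ('k, ('a \<times> 'a \<Rightarrow>\<^sub>0 int) set) module" where
  "tensor_centralizer B A =
    (let T = tensor_over B A; t = tensor_elem_over B A
     in T\<lparr>carrier := {X \<in> carrier T. \<forall>b\<in>B.
           tensor_lift (add_monoid T) (\<lambda>a a'. t (b \<otimes>\<^bsub>A\<^esub> a) a') X
             = tensor_lift (add_monoid T) (\<lambda>a a'. t a (a' \<otimes>\<^bsub>A\<^esub> b)) X}\<rparr>)"

text \<open>\<open>can (a \<otimes> a') = a a'\<^sub>0 \<otimes> a'\<^sub>1\<close>\<close>

definition canonical_map ::
  "('k, 'l) ring_scheme \<Rightarrow> ('k, 'h, 'm) module_scheme \<Rightarrow> ('k, 'a, 'n) module_scheme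
    \<Rightarrow> ('a \<Rightarrow> ('a \<times> 'h \<Rightarrow>\<^sub>0 int) set) \<Rightarrow> ('a \<times> 'a \<Rightarrow>\<^sub>0 int) set \<Rightarrow> ('a \<times> 'h \<Rightarrow>\<^sub>0 int) set" where
  "canonical_map K H A \<rho> =
    (let G = add_monoid (tensor K A H)
     in tensor_lift G (\<lambda>a a'.
          tensor_lift G (\<lambda>x h. tensor_elem K A H (a \<otimes>\<^bsub>A\<^esub> x) h) (\<rho> a')))"

locale hopf_galois_extension = comodule_algebra K H \<Delta> \<epsilon> S A \<rho>
  for K :: "('k, 'l) ring_scheme" and H :: "('k, 'h, 'm) module_scheme"
    and \<Delta> \<epsilon> S and A :: "('k, 'a, 'n) module_scheme" and \<rho> +
  assumes canonical_map_bij: "bij_betw (canonical_map K H A \<rho>)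
    (carrier (tensor_over (coinvariants K H A \<rho>) A)) (carrier (tensor K A H))"

text \<open>
  The coaction on \<open>E = (A \<otimes>\<^sub>B A)\<^sup>B\<close> (for commutative \<open>H\<close>).  The formula
  \<open>a \<otimes> a' \<mapsto> (a \<otimes> a'\<^sub>0) \<otimes> a'\<^sub>1\<close> a priori has values in \<open>(A \<otimes>\<^sub>B A) \<otimes> H\<close>; over a field,
  \<open>E \<otimes> H \<rightarrow> (A \<otimes>\<^sub>B A) \<otimes> H\<close> is injective, and the coaction is the unique lift along it.
\<close>

definition tensor_over_coaction ::
  "('k, 'l) ring_scheme \<Rightarrow> ('k, 'h, 'm) module_scheme \<Rightarrow> ('k, 'a, 'n) module_scheme
    \<Rightarrow> ('a \<Rightarrow> ('a \<times> 'h \<Rightarrow>\<^sub>0 int) set)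
    \<Rightarrow> ('a \<times> 'a \<Rightarrow>\<^sub>0 int) set \<Rightarrow> (('a \<times> 'a \<Rightarrow>\<^sub>0 int) set \<times> 'h \<Rightarrow>\<^sub>0 int) set" where
  "tensor_over_coaction K H A \<rho> =
    (let B = coinvariants K H A \<rho>; T = tensor_over B A; G = add_monoid (tensor K T H)
     in tensor_lift G (\<lambda>a a'.
          tensor_lift G (\<lambda>x h. tensor_elem K T H (tensor_elem_over B A a x) h) (\<rho> a')))"

definition centralizer_coaction ::
  "('k, 'l) ring_scheme \<Rightarrow> ('k, 'h, 'm) module_scheme \<Rightarrow> ('k, 'a, 'n) module_scheme
    \<Rightarrow> ('a \<Rightarrow> ('a \<times> 'h \<Rightarrow>\<^sub>0 int) set)
    \<Rightarrow> ('a \<times> 'a \<Rightarrow>\<^sub>0 int) set \<Rightarrow> (('a \<times> 'a \<Rightarrow>\<^sub>0 int) set \<times> 'h \<Rightarrow>\<^sub>0 int) set" where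
  "centralizer_coaction K H A \<rho> X =
    (let B = coinvariants K H A \<rho>; T = tensor_over B A; E = tensor_centralizer B A
     in THE U. U \<in> carrier (tensor K E H) \<and>
          tensor_map K T H (\<lambda>x. x) (\<lambda>h. h) U = tensor_over_coaction K H A \<rho> X)"

definition translation_map ::
  "('k, 'l) ring_scheme \<Rightarrow> ('k, 'h, 'm) module_scheme \<Rightarrow> ('k, 'a, 'n) module_scheme
    \<Rightarrow> ('a \<Rightarrow> ('a \<times> 'h \<Rightarrow>\<^sub>0 int) set) \<Rightarrow> 'h \<Rightarrow> ('a \<times> 'a \<Rightarrow>\<^sub>0 int) set" where
  "translation_map K H A \<rho> h =
     inv_into (carrier (tensor_over (coinvariants K H A \<rho>) A)) (canonical_map K H A \<rho>)
       (tensor_elem K A H \<one>\<^bsub>A\<^esub> h)"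


section \<open>Total integrals and convolution\<close>

definition total_integral ::
  "('k, 'l) ring_scheme \<Rightarrow> ('k, 'h, 'm) module_scheme \<Rightarrow> ('h \<Rightarrow> ('h \<times> 'h \<Rightarrow>\<^sub>0 int) set)
    \<Rightarrow> ('k, 'e, 'n) module_scheme \<Rightarrow> ('e \<Rightarrow> ('e \<times> 'h \<Rightarrow>\<^sub>0 int) set) \<Rightarrow> ('h \<Rightarrow> 'e) \<Rightarrow> bool" where
  "total_integral K H \<Delta> E \<rho> f \<longleftrightarrow>
     f \<in> linear_maps K H E \<and> f \<one>\<^bsub>H\<^esub> = \<one>\<^bsub>E\<^esub> \<and>
     (\<forall>h\<in>carrier H. tensor_map K E H f (\<lambda>x. x) (\<Delta> h) = \<rho> (f h))"

definition convolution ::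
  "('h \<Rightarrow> ('h \<times> 'h \<Rightarrow>\<^sub>0 int) set) \<Rightarrow> ('k, 'e, 'n) module_scheme
    \<Rightarrow> ('h \<Rightarrow> 'e) \<Rightarrow> ('h \<Rightarrow> 'e) \<Rightarrow> 'h \<Rightarrow> 'e" where
  "convolution \<Delta> E f g h = tensor_lift (add_monoid E) (\<lambda>x y. f x \<otimes>\<^bsub>E\<^esub> g y) (\<Delta> h)"

definition convolution_invertible ::
  "('k, 'l) ring_scheme \<Rightarrow> ('k, 'h, 'm) module_scheme \<Rightarrow> ('h \<Rightarrow> ('h \<times> 'h \<Rightarrow>\<^sub>0 int) set) \<Rightarrow> ('h \<Rightarrow> 'k)
    \<Rightarrow> ('k, 'e, 'n) module_scheme \<Rightarrow> ('h \<Rightarrow> 'e) \<Rightarrow> bool" where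
  "convolution_invertible K H \<Delta> \<epsilon> E f \<longleftrightarrow>
     f \<in> linear_maps K H E \<and>
     (\<exists>g\<in>linear_maps K H E. \<forall>h\<in>carrier H.
        convolution \<Delta> E f g h = \<epsilon> h \<odot>\<^bsub>E\<^esub> \<one>\<^bsub>E\<^esub> \<and> convolution \<Delta> E g f h = \<epsilon> h \<odot>\<^bsub>E\<^esub> \<one>\<^bsub>E\<^esub>)"

end

theory Submission
  imports Defs
begin

text \<open>
  Write \<open>\<kappa> h = can\<^sup>-\<^sup>1 (1 \<otimes> h)\<close>.  The canonical map is
  \<open>can (a \<otimes> a') = (a \<otimes> 1) \<rho>(a')\<close>, a product in the algebra \<open>A \<otimes> H\<close>
  (\<open>can_t\<close>), so it is a bimodule map: \<open>can (a X a') = (a \<otimes> 1) can(X) \<rho>(a')\<close>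
  (\<open>can_sandwich\<close>).  As \<open>can\<close> is injective, each multiplicative claim about \<open>\<kappa>\<close> can be
  checked in \<open>A \<otimes> H\<close>, where \<open>1 \<otimes> h\<close> commutes with every \<open>a \<otimes> 1\<close>.  For \<open>b \<in> B\<close> we have
  \<open>\<rho>(b) = b \<otimes> 1\<close>, whence \<open>b \<kappa>(h) = \<kappa>(h) b\<close> (\<open>translation_closed\<close>).  In the same way
  \<open>can (X \<kappa>(k)) = (1 \<otimes> k) can(X)\<close>, which gives \<open>\<kappa>(h) \<kappa>(k) = \<kappa>(k h)\<close>
  (\<open>translation_antimult\<close>).  For commutative \<open>H\<close> the map \<open>\<kappa>\<close> is therefore a homomorphism of
  algebras, and such a map has the convolution inverse \<open>\<kappa> \<circ> S\<close>.

  Colinearity is coassociativity of \<open>\<rho>\<close> read through \<open>can\<close>: the coaction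
  \<open>a \<otimes> a' \<mapsto> (a \<otimes> a'\<^sub>0) \<otimes> a'\<^sub>1\<close> on \<open>A \<otimes>\<^sub>B A\<close> corresponds to
  \<open>x \<otimes> h \<mapsto> (x \<otimes> h\<^sub>1) \<otimes> h\<^sub>2\<close> on \<open>A \<otimes> H\<close> (\<open>tensor_over_coaction_can\<close>), and the latter
  sends \<open>1 \<otimes> h\<close> to \<open>(1 \<otimes> h\<^sub>1) \<otimes> h\<^sub>2\<close>.  This is an identity in \<open>(A \<otimes>\<^sub>B A) \<otimes> H\<close>; the
  coaction of \<open>E = (A \<otimes>\<^sub>B A)\<^sup>B\<close> is the preimage in \<open>E \<otimes> H\<close>.  The preimage is unique because
  the subspace \<open>E\<close> is a direct summand, so that \<open>E \<otimes> H \<rightarrow> (A \<otimes>\<^sub>B A) \<otimes> H\<close> is injective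
  (\<open>tensor_map_submodule_inj\<close>).

  All maps out of tensor products are obtained from the universal property for linear maps
  (\<open>lift_linear\<close>, \<open>lift_t\<close>), and two of them are compared on pure tensors
  (\<open>linear_maps_eqI\<close>).
\<close>

section \<open>Pure tensors generate the tensor product\<close>

context tensor_setup begin

lemma tensor_coset_eqI:
  assumes "x \<in> carrier F" "y \<in> carrier F" "x - y \<in> Z"
  shows "Z #>\<^bsub>F\<^esub> x = Z #>\<^bsub>F\<^esub> y"
proof -
  have "x \<in> Z #>\<^bsub>F\<^esub> y"
    using assms(3) unfolding r_coset_def by (auto intro!: bexI[of _ "x - y"])
  with assms(2) show ?thesis
    by (intro group.repr_independence[symmetric] group_free_Abelian_group
        normal_imp_subgroup normal_Z)
qed

lemma tensor_coset_add:
  assumes "x \<in> carrier F" "y \<in> carrier F"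
  shows "Z #>\<^bsub>F\<^esub> (x + y) = (Z #>\<^bsub>F\<^esub> x) \<otimes>\<^bsub>tensor_group M N S r l\<^esub> (Z #>\<^bsub>F\<^esub> y)"
  using normal.rcos_sum[OF normal_Z assms] by (simp add: tensor_group_def FactGroup_def)

lemma coset_in_tensor_group:
  assumes "x \<in> carrier F"
  shows "Z #>\<^bsub>F\<^esub> x \<in> carrier (tensor_group M N S r l)"
  using assms by (auto simp: tensor_group_def FactGroup_def RCOSETS_def)

lemma balanced_map_tensor_coset:
  "balanced_map M N S r l (tensor_group M N S r l) (tensor_coset M N S r l)"
proof -
  interpret M: abelian_group M by (rule abM)
  interpret N: abelian_group N by (rule abN)
  have rel: "x \<in> Z" if "x \<in> tensor_relations M N S r l" for x
    using that by (simp add: tensor_null_def generate.incl)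
  have gen: "frag_of (m, n) \<in> carrier F" if "m \<in> carrier M" "n \<in> carrier N" for m n
    using that by simp
  have sum: "x + y \<in> carrier F" if "x \<in> carrier F" "y \<in> carrier F" for x y
    using that keys_add[of x y] by auto
  show ?thesis
    unfolding balanced_map_def tensor_coset_def
  proof (intro conjI ballI)
    fix m m' n assume *: "m \<in> carrier M" "m' \<in> carrier M" "n \<in> carrier N"
    show "Z #>\<^bsub>F\<^esub> frag_of (m \<oplus>\<^bsub>M\<^esub> m', n)
      = (Z #>\<^bsub>F\<^esub> frag_of (m, n)) \<otimes>\<^bsub>tensor_group M N S r l\<^esub> (Z #>\<^bsub>F\<^esub> frag_of (m', n))"
      unfolding tensor_coset_add[OF gen[OF *(1,3)] gen[OF *(2,3)], symmetric]
      by (intro tensor_coset_eqI gen sum rel) (use * in \<open>auto simp: tensor_relations_def\<close>)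
  next
    fix m n n' assume *: "m \<in> carrier M" "n \<in> carrier N" "n' \<in> carrier N"
    show "Z #>\<^bsub>F\<^esub> frag_of (m, n \<oplus>\<^bsub>N\<^esub> n')
      = (Z #>\<^bsub>F\<^esub> frag_of (m, n)) \<otimes>\<^bsub>tensor_group M N S r l\<^esub> (Z #>\<^bsub>F\<^esub> frag_of (m, n'))"
      unfolding tensor_coset_add[OF gen[OF *(1,2)] gen[OF *(1,3)], symmetric]
      by (intro tensor_coset_eqI gen sum rel) (use * in \<open>auto simp: tensor_relations_def\<close>)
  next
    fix m s n assume *: "m \<in> carrier M" "s \<in> S" "n \<in> carrier N"
    show "Z #>\<^bsub>F\<^esub> frag_of (r m s, n) = Z #>\<^bsub>F\<^esub> frag_of (m, l s n)"
      by (intro tensor_coset_eqI gen rel r_closed l_closed)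
         (use * in \<open>auto simp: tensor_relations_def\<close>)
  qed (intro coset_in_tensor_group gen)
qed

text \<open>
  No case for inverses is needed, since \<open>- (m \<otimes> n) = (- m) \<otimes> n\<close> is again a pure tensor; likewise
  the neutral element is \<open>0 \<otimes> 0\<close>.
\<close>

lemma tensor_group_induct:
  assumes X: "X \<in> carrier (tensor_group M N S r l)"
    and pure: "\<And>m n. m \<in> carrier M \<Longrightarrow> n \<in> carrier N \<Longrightarrow> P (tensor_coset M N S r l m n)"
    and add: "\<And>X Y. X \<in> carrier (tensor_group M N S r l) \<Longrightarrow>
      Y \<in> carrier (tensor_group M N S r l) \<Longrightarrow> P X \<Longrightarrow> P Y \<Longrightarrow> P (X \<otimes>\<^bsub>tensor_group M N S r l\<^esub> Y)"
  shows "P X"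
proof -
  interpret M: abelian_group M by (rule abM)
  interpret N: abelian_group N by (rule abN)
  interpret T: comm_group "tensor_group M N S r l" by (rule comm_group_tensor_group)
  interpret Z: normal Z F by (rule normal_Z)
  let ?t = "tensor_coset M N S r l"
  have tc: "?t m n \<in> carrier (tensor_group M N S r l)" if "m \<in> carrier M" "n \<in> carrier N" for m n
    using that balanced_map_tensor_coset by (simp add: balanced_map_def)
  have tadd: "?t (m \<oplus>\<^bsub>M\<^esub> m') n = ?t m n \<otimes>\<^bsub>tensor_group M N S r l\<^esub> ?t m' n"
    if "m \<in> carrier M" "m' \<in> carrier M" "n \<in> carrier N" for m m' n
    using that balanced_map_tensor_coset by (simp add: balanced_map_def)
  have t0: "?t \<zero>\<^bsub>M\<^esub> n = \<one>\<^bsub>tensor_group M N S r l\<^esub>" if "n \<in> carrier N" for n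
    using tadd[of "\<zero>\<^bsub>M\<^esub>" "\<zero>\<^bsub>M\<^esub>" n] tc[of "\<zero>\<^bsub>M\<^esub>" n] that by (simp add: T.l_cancel_one')
  have one: "Z #>\<^bsub>F\<^esub> 0 = \<one>\<^bsub>tensor_group M N S r l\<^esub>"
    using Z.subset by (simp add: tensor_group_def FactGroup_def r_coset_def)
  have minus: "?t (\<ominus>\<^bsub>M\<^esub> m) n = Z #>\<^bsub>F\<^esub> (- frag_of (m, n))" if "m \<in> carrier M" "n \<in> carrier N" for m n
  proof -
    have f: "frag_of (m, n) \<in> carrier F" "- frag_of (m, n) \<in> carrier F"
      using that by (auto simp: keys_minus)
    have "?t (\<ominus>\<^bsub>M\<^esub> m) n \<otimes>\<^bsub>tensor_group M N S r l\<^esub> ?t m n = \<one>\<^bsub>tensor_group M N S r l\<^esub>"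
      using that by (simp add: tadd[symmetric] M.l_neg t0)
    moreover have "(Z #>\<^bsub>F\<^esub> (- frag_of (m, n))) \<otimes>\<^bsub>tensor_group M N S r l\<^esub> ?t m n
        = \<one>\<^bsub>tensor_group M N S r l\<^esub>"
      unfolding tensor_coset_def tensor_coset_add[OF f(2,1), symmetric] using one by simp
    ultimately show ?thesis
      using T.right_cancel[of "?t m n"] tc that coset_in_tensor_group[OF f(2)] M.a_inv_closed[of m]
      by metis
  qed
  obtain x where x: "x \<in> carrier F" "X = Z #>\<^bsub>F\<^esub> x"
    using X by (auto simp: tensor_group_def FactGroup_def RCOSETS_def)
  have k: "Poly_Mapping.keys x \<subseteq> carrier M \<times> carrier N" using x(1) by simp
  \<comment> \<open>Tracking \<open>x\<close> together with \<open>- x\<close> turns the subtraction step of the free group into additions.\<close>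
  have "x \<in> carrier F \<and> P (Z #>\<^bsub>F\<^esub> x) \<and> P (Z #>\<^bsub>F\<^esub> (- x))" 
    (is "?Q x")
  proof (rule free_Abelian_group_induct[of x "carrier M \<times> carrier N" ?Q, OF k], goal_cases)
    case 1
    have "P (?t \<zero>\<^bsub>M\<^esub> \<zero>\<^bsub>N\<^esub>)" by (intro pure) auto
    then show ?case by (simp add: one t0)
  next
    case (2 x y)
    then have c: "x \<in> carrier F" "y \<in> carrier F" "-x \<in> carrier F" "-y \<in> carrier F"
      by (auto simp: keys_minus)
    have "P (Z #>\<^bsub>F\<^esub> (x + - y))" "P (Z #>\<^bsub>F\<^esub> (- x + y))"
      using 2 c by (auto simp only: tensor_coset_add intro!: add coset_in_tensor_group)
    moreover have "x - y \<in> carrier F" using c keys_diff[of x y] by auto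
    ultimately show ?case by (simp del: carrier_free_Abelian_group_iff)
  next
    case (3 a)
    then obtain m n where a: "a = (m, n)" "m \<in> carrier M" "n \<in> carrier N" by auto
    have "P (?t m n)" "P (?t (\<ominus>\<^bsub>M\<^esub> m) n)" using a by (auto intro: pure)
    then show ?case using a minus by (simp add: tensor_coset_def)
  qed
  then show ?thesis by (simp add: x)
qed

end

section \<open>Linear and bilinear maps\<close>

lemma linear_mapsI:
  assumes "\<And>x. x \<in> carrier M \<Longrightarrow> f x \<in> carrier N"
    and "\<And>x y. x \<in> carrier M \<Longrightarrow> y \<in> carrier M \<Longrightarrow> f (x \<oplus>\<^bsub>M\<^esub> y) = f x \<oplus>\<^bsub>N\<^esub> f y"
    and "\<And>c x. c \<in> carrier K \<Longrightarrow> x \<in> carrier M \<Longrightarrow> f (c \<odot>\<^bsub>M\<^esub> x) = c \<odot>\<^bsub>N\<^esub> f x"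
  shows "f \<in> linear_maps K M N"
  using assms by (auto simp: linear_maps_def)

lemma linear_mapsD:
  assumes "f \<in> linear_maps K M N"
  shows "x \<in> carrier M \<Longrightarrow> f x \<in> carrier N"
    and "x \<in> carrier M \<Longrightarrow> y \<in> carrier M \<Longrightarrow> f (x \<oplus>\<^bsub>M\<^esub> y) = f x \<oplus>\<^bsub>N\<^esub> f y"
    and "c \<in> carrier K \<Longrightarrow> x \<in> carrier M \<Longrightarrow> f (c \<odot>\<^bsub>M\<^esub> x) = c \<odot>\<^bsub>N\<^esub> f x"
  using assms by (auto simp: linear_maps_def)

lemma linear_maps_id: "(\<lambda>x. x) \<in> linear_maps K M M"
  by (simp add: linear_maps_def)

lemma linear_maps_compose:
  assumes "f \<in> linear_maps K M N" "g \<in> linear_maps K N P"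
  shows "(\<lambda>x. g (f x)) \<in> linear_maps K M P"
  using assms by (auto simp: linear_maps_def Pi_iff)

lemma linear_maps_cong:
  assumes "f \<in> linear_maps K M N" "module K M" "\<And>x. x \<in> carrier M \<Longrightarrow> g x = f x"
  shows "g \<in> linear_maps K M N"
proof -
  interpret module K M by (rule assms(2))
  show ?thesis using assms by (auto simp: linear_maps_def)
qed

definition bilinear_map ::
  "('k, 'l) ring_scheme \<Rightarrow> ('k, 'a, 'm) module_scheme \<Rightarrow> ('k, 'b, 'n) module_scheme
    \<Rightarrow> ('k, 'c, 'p) module_scheme \<Rightarrow> ('a \<Rightarrow> 'b \<Rightarrow> 'c) \<Rightarrow> bool" where
  "bilinear_map K M N P f \<longleftrightarrow>
     (\<forall>m\<in>carrier M. f m \<in> linear_maps K N P) \<and>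
     (\<forall>n\<in>carrier N. (\<lambda>m. f m n) \<in> linear_maps K M P)"

lemma bilinear_mapD:
  assumes "bilinear_map K M N P f"
  shows "m \<in> carrier M \<Longrightarrow> f m \<in> linear_maps K N P"
    and "n \<in> carrier N \<Longrightarrow> (\<lambda>m. f m n) \<in> linear_maps K M P"
    and "m \<in> carrier M \<Longrightarrow> n \<in> carrier N \<Longrightarrow> f m n \<in> carrier P"
  using assms by (auto simp: bilinear_map_def linear_maps_def)

lemma bilinear_mapI:
  assumes "\<And>m. m \<in> carrier M \<Longrightarrow> f m \<in> linear_maps K N P"
    and "\<And>n. n \<in> carrier N \<Longrightarrow> (\<lambda>m. f m n) \<in> linear_maps K M P"
  shows "bilinear_map K M N P f"
  using assms by (auto simp: bilinear_map_def)

lemma bilinear_map_compose: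
  assumes "bilinear_map K M N P f" "g \<in> linear_maps K P Q"
  shows "bilinear_map K M N Q (\<lambda>m n. g (f m n))"
  using assms by (auto simp: bilinear_map_def intro: linear_maps_compose)

lemma bilinear_map_compose_args:
  assumes "bilinear_map K M N P f" "g \<in> linear_maps K M' M" "h \<in> linear_maps K N' N"
  shows "bilinear_map K M' N' P (\<lambda>m n. f (g m) (h n))"
  by (intro bilinear_mapI linear_maps_compose[OF assms(3)]
      linear_maps_compose[OF assms(2), of "\<lambda>m. f m (h _)"] bilinear_mapD[OF assms(1)]
      linear_mapsD(1)[OF assms(2)] linear_mapsD(1)[OF assms(3)])

section \<open>Balanced tensor products as vector spaces\<close>

text \<open>
  A balanced tensor product whose left factor is a vector space carries the vector space structure
  given by \<open>c (m \<otimes> n) = c m \<otimes> n\<close>.  The tensor product over the field and the one over the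
  coinvariants are both of this form, which is why their theory is developed together.
\<close>

locale balanced_tensor = tensor_setup M N S r l + module K M
  for K :: "('k, 'p) ring_scheme" and M :: "('k, 'a, 'm) module_scheme"
    and N :: "('b, 'n) ring_scheme" and S :: "'s set" and r l +
  fixes T :: "('k, ('a \<times> 'b \<Rightarrow>\<^sub>0 int) set) module"
    and t :: "'a \<Rightarrow> 'b \<Rightarrow> ('a \<times> 'b \<Rightarrow>\<^sub>0 int) set"
  assumes r_smult: "\<And>c m s. c \<in> carrier K \<Longrightarrow> m \<in> carrier M \<Longrightarrow> s \<in> S \<Longrightarrow>
      r (c \<odot>\<^bsub>M\<^esub> m) s = c \<odot>\<^bsub>M\<^esub> r m s"
    and t_eq: "t = tensor_coset M N S r l"
    and carrier_T: "carrier T = carrier (tensor_group M N S r l)"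
    and add_T: "add T = mult (tensor_group M N S r l)"
    and zero_T: "zero T = one (tensor_group M N S r l)"
    and smult_T: "smult T = (\<lambda>c. tensor_lift (tensor_group M N S r l) (\<lambda>m n. t (c \<odot>\<^bsub>M\<^esub> m) n))"
begin

lemma abelian_group_T: "abelian_group T"
proof -
  interpret G: comm_group "tensor_group M N S r l" by (rule comm_group_tensor_group)
  show ?thesis
    by (rule abelian_groupI)
       (auto simp: carrier_T add_T zero_T G.m_ac intro: G.l_inv_ex)
qed

lemma balanced_t: "balanced_map M N S r l (tensor_group M N S r l) t"
  unfolding t_eq by (rule balanced_map_tensor_coset)

lemma t_closed: "m \<in> carrier M \<Longrightarrow> n \<in> carrier N \<Longrightarrow> t m n \<in> carrier T"
  and t_add_left: "m \<in> carrier M \<Longrightarrow> m' \<in> carrier M \<Longrightarrow> n \<in> carrier N \<Longrightarrow>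
    t (m \<oplus>\<^bsub>M\<^esub> m') n = t m n \<oplus>\<^bsub>T\<^esub> t m' n"
  and t_add_right: "m \<in> carrier M \<Longrightarrow> n \<in> carrier N \<Longrightarrow> n' \<in> carrier N \<Longrightarrow>
    t m (n \<oplus>\<^bsub>N\<^esub> n') = t m n \<oplus>\<^bsub>T\<^esub> t m n'"
  and t_balanced: "m \<in> carrier M \<Longrightarrow> s \<in> S \<Longrightarrow> n \<in> carrier N \<Longrightarrow> t (r m s) n = t m (l s n)"
  using balanced_t by (simp_all add: balanced_map_def carrier_T add_T)

lemma T_induct [consumes 1, case_names pure add]:
  assumes "X \<in> carrier T"
    and "\<And>m n. m \<in> carrier M \<Longrightarrow> n \<in> carrier N \<Longrightarrow> P (t m n)"
    and "\<And>X Y. X \<in> carrier T \<Longrightarrow> Y \<in> carrier T \<Longrightarrow> P X \<Longrightarrow> P Y \<Longrightarrow> P (X \<oplus>\<^bsub>T\<^esub> Y)"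
  shows "P X"
  using tensor_group_induct[of X P] assms by (simp add: carrier_T add_T t_eq)

lemma lift_pure:
  assumes "comm_group G" "balanced_map M N S r l G \<psi>" "m \<in> carrier M" "n \<in> carrier N"
  shows "tensor_lift G \<psi> (t m n) = \<psi> m n"
  unfolding t_eq by (rule tensor_lift_coset[OF assms])

lemma balanced_map_smult:
  assumes "c \<in> carrier K"
  shows "balanced_map M N S r l (tensor_group M N S r l) (\<lambda>m n. t (c \<odot>\<^bsub>M\<^esub> m) n)"
  using assms balanced_t by (simp add: balanced_map_def smult_r_distr r_smult[symmetric])

lemma t_smult:
  assumes "c \<in> carrier K" "m \<in> carrier M" "n \<in> carrier N"
  shows "c \<odot>\<^bsub>T\<^esub> t m n = t (c \<odot>\<^bsub>M\<^esub> m) n"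
  unfolding smult_T
  by (rule lift_pure[OF comm_group_tensor_group balanced_map_smult]) (use assms in auto)

lemma smult_T_hom:
  assumes "c \<in> carrier K"
  shows "(\<lambda>X. c \<odot>\<^bsub>T\<^esub> X) \<in> hom (tensor_group M N S r l) (tensor_group M N S r l)"
  unfolding smult_T
  by (rule tensor_lift_hom[OF comm_group_tensor_group balanced_map_smult[OF assms]])

lemma smult_T_closed: "c \<in> carrier K \<Longrightarrow> X \<in> carrier T \<Longrightarrow> c \<odot>\<^bsub>T\<^esub> X \<in> carrier T"
  using hom_in_carrier[OF smult_T_hom] by (simp add: carrier_T)

lemma smult_T_add:
  "c \<in> carrier K \<Longrightarrow> X \<in> carrier T \<Longrightarrow> Y \<in> carrier T \<Longrightarrow>
    c \<odot>\<^bsub>T\<^esub> (X \<oplus>\<^bsub>T\<^esub> Y) = c \<odot>\<^bsub>T\<^esub> X \<oplus>\<^bsub>T\<^esub> c \<odot>\<^bsub>T\<^esub> Y"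
  using hom_mult[OF smult_T_hom] by (simp add: carrier_T add_T)

lemma module_T: "module K T"
proof (rule moduleI)
  interpret T: abelian_group T by (rule abelian_group_T)
  fix a b X assume ab: "a \<in> carrier K" "b \<in> carrier K" and X: "X \<in> carrier T"
  show "(a \<oplus>\<^bsub>K\<^esub> b) \<odot>\<^bsub>T\<^esub> X = a \<odot>\<^bsub>T\<^esub> X \<oplus>\<^bsub>T\<^esub> b \<odot>\<^bsub>T\<^esub> X"
    using X by (induction X rule: T_induct)
      (simp_all add: ab t_smult smult_l_distr t_add_left smult_T_add smult_T_closed T.a_ac)
  show "(a \<otimes>\<^bsub>K\<^esub> b) \<odot>\<^bsub>T\<^esub> X = a \<odot>\<^bsub>T\<^esub> (b \<odot>\<^bsub>T\<^esub> X)"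
    using X by (induction X rule: T_induct)
      (simp_all add: ab t_smult smult_assoc1 smult_T_add smult_T_closed)
next
  fix X assume X: "X \<in> carrier T"
  show "\<one>\<^bsub>K\<^esub> \<odot>\<^bsub>T\<^esub> X = X"
    using X by (induction X rule: T_induct) (simp_all add: t_smult smult_T_add)
qed (simp_all add: module.axioms(1)[OF module_axioms] abelian_group_T smult_T_closed smult_T_add)

text \<open>
  Homogeneity is demanded in the left argument only, because the right factor is a mere abelian
  group.
\<close>

definition balanced_linear :: "('k, 'c, 'q) module_scheme \<Rightarrow> ('a \<Rightarrow> 'b \<Rightarrow> 'c) \<Rightarrow> bool" where
  "balanced_linear P f \<longleftrightarrow>
     (\<forall>n\<in>carrier N. (\<lambda>m. f m n) \<in> linear_maps K M P)
   \<and> (\<forall>m\<in>carrier M. \<forall>n\<in>carrier N. \<forall>n'\<in>carrier N. f m (n \<oplus>\<^bsub>N\<^esub> n') = f m n \<oplus>\<^bsub>P\<^esub> f m n')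
   \<and> (\<forall>m\<in>carrier M. \<forall>s\<in>S. \<forall>n\<in>carrier N. f (r m s) n = f m (l s n))"

lemma balanced_linearI:
  assumes "\<And>n. n \<in> carrier N \<Longrightarrow> (\<lambda>m. f m n) \<in> linear_maps K M P"
    and "\<And>m n n'. m \<in> carrier M \<Longrightarrow> n \<in> carrier N \<Longrightarrow> n' \<in> carrier N \<Longrightarrow>
      f m (n \<oplus>\<^bsub>N\<^esub> n') = f m n \<oplus>\<^bsub>P\<^esub> f m n'"
    and "\<And>m s n. m \<in> carrier M \<Longrightarrow> s \<in> S \<Longrightarrow> n \<in> carrier N \<Longrightarrow> f (r m s) n = f m (l s n)"
  shows "balanced_linear P f"
  using assms by (simp add: balanced_linear_def)

lemma balanced_linear_cong:
  assumes f: "balanced_linear P f"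
    and eq: "\<And>m n. m \<in> carrier M \<Longrightarrow> n \<in> carrier N \<Longrightarrow> g m n = f m n"
  shows "balanced_linear P g"
proof (rule balanced_linearI)
  interpret N: abelian_group N by (rule abN)
  show "(\<lambda>m. g m n) \<in> linear_maps K M P" if "n \<in> carrier N" for n
    using f that by (rule_tac linear_maps_cong[OF _ module_axioms, of "\<lambda>m. f m n"])
      (simp_all add: balanced_linear_def eq)
  show "g m (n \<oplus>\<^bsub>N\<^esub> n') = g m n \<oplus>\<^bsub>P\<^esub> g m n'"
    if "m \<in> carrier M" "n \<in> carrier N" "n' \<in> carrier N" for m n n'
    using f that by (simp add: balanced_linear_def eq)
  show "g (r m s) n = g m (l s n)" if "m \<in> carrier M" "s \<in> S" "n \<in> carrier N" for m s n
    using f that by (simp add: balanced_linear_def eq r_closed l_closed)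
qed

lemma
  assumes P: "module K P" and f: "balanced_linear P f"
  shows lift_linear: "tensor_lift (add_monoid P) f \<in> linear_maps K T P"
    and lift_t: "\<And>m n. m \<in> carrier M \<Longrightarrow> n \<in> carrier N \<Longrightarrow> tensor_lift (add_monoid P) f (t m n) = f m n"
proof -
  interpret P: module K P by (rule P)
  have left: "(\<lambda>m. f m n) \<in> linear_maps K M P" if "n \<in> carrier N" for n
    using f that by (simp add: balanced_linear_def)
  have G: "comm_group (add_monoid P)" by (rule P.a_comm_group)
  have b: "balanced_map M N S r l (add_monoid P) f"
    using f linear_mapsD(1,2)[OF left] by (simp add: balanced_map_def balanced_linear_def)
  note hom = tensor_lift_hom[OF G b]
  show pure: "tensor_lift (add_monoid P) f (t m n) = f m n"
    if "m \<in> carrier M" "n \<in> carrier N" for m n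
    by (rule lift_pure[OF G b that])
  have closed: "tensor_lift (add_monoid P) f X \<in> carrier P" if "X \<in> carrier T" for X
    using hom_in_carrier[OF hom] that by (simp add: carrier_T)
  have sum: "tensor_lift (add_monoid P) f (X \<oplus>\<^bsub>T\<^esub> Y)
      = tensor_lift (add_monoid P) f X \<oplus>\<^bsub>P\<^esub> tensor_lift (add_monoid P) f Y"
    if "X \<in> carrier T" "Y \<in> carrier T" for X Y
    using hom_mult[OF hom] that by (simp add: carrier_T add_T)
  show "tensor_lift (add_monoid P) f \<in> linear_maps K T P"
  proof (rule linear_mapsI)
    fix c X assume c: "c \<in> carrier K" and "X \<in> carrier T"
    from this(2) show "tensor_lift (add_monoid P) f (c \<odot>\<^bsub>T\<^esub> X)
        = c \<odot>\<^bsub>P\<^esub> tensor_lift (add_monoid P) f X"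
      by (induction X rule: T_induct)
         (simp_all add: c t_smult pure linear_mapsD(3)[OF left] smult_T_add sum closed
           smult_T_closed P.smult_r_distr)
  qed (simp_all add: closed sum)
qed

text \<open>
  The records \<open>tensor_group M N S r l\<close> and \<open>add_monoid T\<close> describe the same group but differ in
  their extension field.  The products of tensor algebras are lifts into the former, whereas
  the universal property is stated for the latter.
\<close>

lemma tensor_lift_tensor_group:
  assumes f: "balanced_linear T f" and X: "X \<in> carrier T"
  shows "tensor_lift (tensor_group M N S r l) f X = tensor_lift (add_monoid T) f X"
proof -
  have left: "(\<lambda>m. f m n) \<in> linear_maps K M T" if "n \<in> carrier N" for n
    using f that by (simp add: balanced_linear_def)
  have b: "balanced_map M N S r l (tensor_group M N S r l) f"
    using f linear_mapsD(1,2)[OF left]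
    by (simp add: balanced_map_def balanced_linear_def carrier_T add_T)
  have sum: "tensor_lift (tensor_group M N S r l) f (X \<oplus>\<^bsub>T\<^esub> Y)
      = tensor_lift (tensor_group M N S r l) f X \<oplus>\<^bsub>T\<^esub> tensor_lift (tensor_group M N S r l) f Y"
    if "X \<in> carrier T" "Y \<in> carrier T" for X Y
    using hom_mult[OF tensor_lift_hom[OF comm_group_tensor_group b]] that
    by (simp add: carrier_T add_T)
  from X show ?thesis
    by (induction X rule: T_induct)
       (simp_all add: lift_t[OF module_T f] lift_pure[OF comm_group_tensor_group b] sum
         linear_mapsD(2)[OF lift_linear[OF module_T f]])
qed

text \<open>
  This makes iterated lifts possible: \<open>x \<mapsto> \<Sum> f x m\<^sub>i n\<^sub>i\<close> is linear for a fixed tensor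
  \<open>\<Sum> m\<^sub>i \<otimes> n\<^sub>i\<close>, so it can itself be an argument of the universal property.
\<close>

lemma lift_linear_parameter:
  assumes P: "module K P" and Q: "module K Q"
    and f: "\<And>x. x \<in> carrier Q \<Longrightarrow> balanced_linear P (f x)"
    and lin: "\<And>m n. m \<in> carrier M \<Longrightarrow> n \<in> carrier N \<Longrightarrow> (\<lambda>x. f x m n) \<in> linear_maps K Q P"
    and X: "X \<in> carrier T"
  shows "(\<lambda>x. tensor_lift (add_monoid P) (f x) X) \<in> linear_maps K Q P"
proof -
  interpret P: module K P by (rule P)
  interpret Q: module K Q by (rule Q)
  note L = lift_linear[OF P f]
  note D = linear_mapsD[OF L] lift_t[OF P f] linear_mapsD[OF lin]
  have add: "tensor_lift (add_monoid P) (f (x \<oplus>\<^bsub>Q\<^esub> y)) X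
      = tensor_lift (add_monoid P) (f x) X \<oplus>\<^bsub>P\<^esub> tensor_lift (add_monoid P) (f y) X"
    if xy: "x \<in> carrier Q" "y \<in> carrier Q" for x y
    using X by (induction X rule: T_induct) (simp_all add: D xy P.a_ac)
  have smult: "tensor_lift (add_monoid P) (f (c \<odot>\<^bsub>Q\<^esub> x)) X
      = c \<odot>\<^bsub>P\<^esub> tensor_lift (add_monoid P) (f x) X"
    if cx: "c \<in> carrier K" "x \<in> carrier Q" for c x
    using X by (induction X rule: T_induct) (simp_all add: D cx P.smult_r_distr)
  show ?thesis by (intro linear_mapsI) (simp_all add: D add smult X)
qed

lemma linear_maps_eqI:
  assumes "f \<in> linear_maps K T P" "g \<in> linear_maps K T P" "X \<in> carrier T"
    and "\<And>m n. m \<in> carrier M \<Longrightarrow> n \<in> carrier N \<Longrightarrow> f (t m n) = g (t m n)"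
  shows "f X = g X"
  using assms(3) by (induction X rule: T_induct)
    (simp_all add: assms(4) linear_mapsD(2)[OF assms(1)] linear_mapsD(2)[OF assms(2)])

lemma lift_cong:
  assumes P: "module K P" and f: "balanced_linear P f" and X: "X \<in> carrier T"
    and eq: "\<And>m n. m \<in> carrier M \<Longrightarrow> n \<in> carrier N \<Longrightarrow> g m n = f m n"
  shows "tensor_lift (add_monoid P) g X = tensor_lift (add_monoid P) f X"
proof -
  have g: "balanced_linear P g" by (rule balanced_linear_cong[OF f eq])
  show ?thesis
    by (rule linear_maps_eqI[OF lift_linear[OF P g] lift_linear[OF P f] X])
       (simp add: lift_t[OF P f] lift_t[OF P g] eq)
qed

end

section \<open>Tensor products over the field\<close>

lemma balanced_tensor_field:
  assumes M: "module K M" and N: "module K N"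
  shows "balanced_tensor K M N (carrier K) (\<lambda>m c. c \<odot>\<^bsub>M\<^esub> m) (\<lambda>c n. c \<odot>\<^bsub>N\<^esub> n)
    (tensor K M N) (tensor_elem K M N)"
proof -
  interpret M: module K M by (rule M)
  interpret N: module K N by (rule N)
  show ?thesis
  proof unfold_locales
    fix c m s assume "c \<in> carrier K" "m \<in> carrier M" "s \<in> carrier K"
    then show "s \<odot>\<^bsub>M\<^esub> (c \<odot>\<^bsub>M\<^esub> m) = c \<odot>\<^bsub>M\<^esub> (s \<odot>\<^bsub>M\<^esub> m)"
      by (simp add: M.smult_assoc1[symmetric] M.R.m_comm)
  qed (simp_all add: tensor_elem_def tensor_def Let_def fun_eq_iff)
qed

lemma module_tensor:
  assumes "module K M" "module K N" shows "module K (tensor K M N)"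
  by (rule balanced_tensor.module_T[OF balanced_tensor_field[OF assms]])

lemma tensor_elem_bilinear:
  assumes M: "module K M" and N: "module K N"
  shows "bilinear_map K M N (tensor K M N) (tensor_elem K M N)"
proof -
  interpret balanced_tensor K M N "carrier K" "\<lambda>m c. c \<odot>\<^bsub>M\<^esub> m" "\<lambda>c n. c \<odot>\<^bsub>N\<^esub> n"
    "tensor K M N" "tensor_elem K M N"
    by (rule balanced_tensor_field[OF assms])
  show ?thesis
    by (intro bilinear_mapI linear_mapsI)
       (simp_all add: t_closed t_add_left t_add_right t_smult t_balanced)
qed

lemma bilinear_map_balanced_linear:
  assumes M: "module K M" and N: "module K N" and f: "bilinear_map K M N P f"
  shows "balanced_tensor.balanced_linear K M N (carrier K)
    (\<lambda>m c. c \<odot>\<^bsub>M\<^esub> m) (\<lambda>c n. c \<odot>\<^bsub>N\<^esub> n) P f"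
proof -
  note D = linear_mapsD[OF bilinear_mapD(1)[OF f]] linear_mapsD[OF bilinear_mapD(2)[OF f]]
  show ?thesis
    by (rule balanced_tensor.balanced_linearI[OF balanced_tensor_field[OF M N]])
       (simp_all add: bilinear_mapD(2)[OF f] D)
qed

lemma
  assumes M: "module K M" and N: "module K N" and P: "module K P"
    and f: "bilinear_map K M N P f"
  shows tensor_lift_linear: "tensor_lift (add_monoid P) f \<in> linear_maps K (tensor K M N) P"
    and tensor_lift_elem: "\<And>m n. m \<in> carrier M \<Longrightarrow> n \<in> carrier N \<Longrightarrow>
      tensor_lift (add_monoid P) f (tensor_elem K M N m n) = f m n"
  using balanced_tensor.lift_linear[OF balanced_tensor_field[OF M N] P
      bilinear_map_balanced_linear[OF M N f]]
    balanced_tensor.lift_t[OF balanced_tensor_field[OF M N] P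
      bilinear_map_balanced_linear[OF M N f]]
  by blast+

lemma tensor_lift_linear_parameter:
  assumes M: "module K M" and N: "module K N" and P: "module K P" and Q: "module K Q"
    and f: "\<And>x. x \<in> carrier Q \<Longrightarrow> bilinear_map K M N P (f x)"
    and lin: "\<And>m n. m \<in> carrier M \<Longrightarrow> n \<in> carrier N \<Longrightarrow> (\<lambda>x. f x m n) \<in> linear_maps K Q P"
    and X: "X \<in> carrier (tensor K M N)"
  shows "(\<lambda>x. tensor_lift (add_monoid P) (f x) X) \<in> linear_maps K Q P"
  by (rule balanced_tensor.lift_linear_parameter[OF balanced_tensor_field[OF M N] P Q
        bilinear_map_balanced_linear[OF M N f] lin X])

lemma tensor_linear_maps_eqI:
  assumes "module K M" "module K N"
    and "f \<in> linear_maps K (tensor K M N) P" "g \<in> linear_maps K (tensor K M N) P"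
    and "X \<in> carrier (tensor K M N)"
    and "\<And>m n. m \<in> carrier M \<Longrightarrow> n \<in> carrier N \<Longrightarrow>
      f (tensor_elem K M N m n) = g (tensor_elem K M N m n)"
  shows "f X = g X"
  by (rule balanced_tensor.linear_maps_eqI[OF balanced_tensor_field[OF assms(1,2)] assms(3-6)])

lemma tensor_lift_cong:
  assumes M: "module K M" and N: "module K N" and P: "module K P"
    and f: "bilinear_map K M N P f" and g: "bilinear_map K M N P g"
    and X: "X \<in> carrier (tensor K M N)"
    and eq: "\<And>m n. m \<in> carrier M \<Longrightarrow> n \<in> carrier N \<Longrightarrow> f m n = g m n"
  shows "tensor_lift (add_monoid P) f X = tensor_lift (add_monoid P) g X"
  by (rule tensor_linear_maps_eqI[OF M N tensor_lift_linear[OF M N P f]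
        tensor_lift_linear[OF M N P g] X])
     (simp add: tensor_lift_elem[OF M N P f] tensor_lift_elem[OF M N P g] eq)

lemma linear_map_tensor_lift:
  assumes M: "module K M" and N: "module K N" and P: "module K P" and Q: "module K Q"
    and f: "bilinear_map K M N P f" and g: "g \<in> linear_maps K P Q"
    and X: "X \<in> carrier (tensor K M N)"
  shows "g (tensor_lift (add_monoid P) f X) = tensor_lift (add_monoid Q) (\<lambda>m n. g (f m n)) X"
proof -
  note gf = bilinear_map_compose[OF f g]
  show ?thesis
    by (rule tensor_linear_maps_eqI[OF M N
          linear_maps_compose[OF tensor_lift_linear[OF M N P f] g]
          tensor_lift_linear[OF M N Q gf] X])
       (simp add: tensor_lift_elem[OF M N P f] tensor_lift_elem[OF M N Q gf])
qed

lemma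
  assumes M: "module K M" and N: "module K N" and M': "module K M'" and N': "module K N'"
    and f: "f \<in> linear_maps K M M'" and g: "g \<in> linear_maps K N N'"
  shows tensor_map_linear: "tensor_map K M' N' f g \<in> linear_maps K (tensor K M N) (tensor K M' N')"
    and tensor_map_elem: "\<And>m n. m \<in> carrier M \<Longrightarrow> n \<in> carrier N \<Longrightarrow>
      tensor_map K M' N' f g (tensor_elem K M N m n) = tensor_elem K M' N' (f m) (g n)"
  unfolding tensor_map_def
  using tensor_lift_linear[OF M N module_tensor[OF M' N']
      bilinear_map_compose_args[OF tensor_elem_bilinear[OF M' N'] f g]]
    tensor_lift_elem[OF M N module_tensor[OF M' N']
      bilinear_map_compose_args[OF tensor_elem_bilinear[OF M' N'] f g]]
  by blast+

lemma
  assumes X: "module K X" and Y: "module K Y" and Z: "module K Z"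
  shows tensor_assoc_linear: "tensor_assoc K X Y Z
      \<in> linear_maps K (tensor K (tensor K X Y) Z) (tensor K X (tensor K Y Z))"
    and tensor_assoc_elem: "\<And>x y z. x \<in> carrier X \<Longrightarrow> y \<in> carrier Y \<Longrightarrow> z \<in> carrier Z \<Longrightarrow>
      tensor_assoc K X Y Z (tensor_elem K (tensor K X Y) Z (tensor_elem K X Y x y) z)
        = tensor_elem K X (tensor K Y Z) x (tensor_elem K Y Z y z)"
proof -
  let ?P = "tensor K X (tensor K Y Z)"
  define f where "f z = (\<lambda>x y. tensor_elem K X (tensor K Y Z) x (tensor_elem K Y Z y z))" for z
  note YZ = module_tensor[OF Y Z] and XY = module_tensor[OF X Y]
  note P = module_tensor[OF X YZ]
  note b = tensor_elem_bilinear[OF X YZ] tensor_elem_bilinear[OF Y Z] tensor_elem_bilinear[OF X Y]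
  have f: "bilinear_map K X Y ?P (f z)" if "z \<in> carrier Z" for z
    unfolding f_def
    by (rule bilinear_map_compose_args[OF b(1) linear_maps_id bilinear_mapD(2)[OF b(2) that]])
  have f_z: "(\<lambda>z. f z x y) \<in> linear_maps K Z ?P" if "x \<in> carrier X" "y \<in> carrier Y" for x y
    unfolding f_def
    by (rule linear_maps_compose[OF bilinear_mapD(1)[OF b(2) that(2)] bilinear_mapD(1)[OF b(1) that(1)]])
  have F: "bilinear_map K (tensor K X Y) Z ?P (\<lambda>u z. tensor_lift (add_monoid ?P) (f z) u)"
  proof (rule bilinear_mapI)
    fix u assume u: "u \<in> carrier (tensor K X Y)"
    show "(\<lambda>z. tensor_lift (add_monoid ?P) (f z) u) \<in> linear_maps K Z ?P"
      by (rule tensor_lift_linear_parameter[OF X Y P Z f f_z u])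
  next
    fix z assume "z \<in> carrier Z"
    then show "tensor_lift (add_monoid ?P) (f z) \<in> linear_maps K (tensor K X Y) ?P"
      by (rule tensor_lift_linear[OF X Y P f])
  qed
  have eq: "tensor_assoc K X Y Z
      = tensor_lift (add_monoid ?P) (\<lambda>u z. tensor_lift (add_monoid ?P) (f z) u)"
    by (simp add: tensor_assoc_def f_def Let_def)
  show "tensor_assoc K X Y Z \<in> linear_maps K (tensor K (tensor K X Y) Z) ?P"
    unfolding eq by (rule tensor_lift_linear[OF XY Z P F])
  show "tensor_assoc K X Y Z (tensor_elem K (tensor K X Y) Z (tensor_elem K X Y x y) z)
      = tensor_elem K X (tensor K Y Z) x (tensor_elem K Y Z y z)"
    if "x \<in> carrier X" "y \<in> carrier Y" "z \<in> carrier Z" for x y z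
  proof -
    have "tensor_elem K X Y x y \<in> carrier (tensor K X Y)"
      using that by (simp add: bilinear_mapD(3)[OF b(3)])
    then show ?thesis
      unfolding eq using that
      by (simp add: tensor_lift_elem[OF XY Z P F] tensor_lift_elem[OF X Y P f]) (simp add: f_def)
  qed
qed

section \<open>The tensor product of two algebras\<close>

lemma linear_map_mult_left:
  assumes "assoc_algebra K A" "a \<in> carrier A"
  shows "(\<lambda>x. a \<otimes>\<^bsub>A\<^esub> x) \<in> linear_maps K A A"
proof -
  interpret A: assoc_algebra K A by (rule assms(1))
  show ?thesis using assms(2) by (intro linear_mapsI) (simp_all add: A.r_distr A.smult_mult_right)
qed

lemma linear_map_mult_right:
  assumes "assoc_algebra K A" "a \<in> carrier A"
  shows "(\<lambda>x. x \<otimes>\<^bsub>A\<^esub> a) \<in> linear_maps K A A"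
proof -
  interpret A: assoc_algebra K A by (rule assms(1))
  show ?thesis using assms(2) by (intro linear_mapsI) (simp_all add: A.l_distr A.smult_mult_left)
qed

lemma assoc_algebra_module: "assoc_algebra K A \<Longrightarrow> module K A"
  by (simp add: assoc_algebra_def)

lemma
  assumes A: "assoc_algebra K A" and H: "assoc_algebra K H"
  shows assoc_algebra_tensor: "assoc_algebra K (tensor K A H)"
    and tensor_elem_mult: "\<And>a h a' h'. a \<in> carrier A \<Longrightarrow> h \<in> carrier H \<Longrightarrow> a' \<in> carrier A \<Longrightarrow>
      h' \<in> carrier H \<Longrightarrow> tensor_elem K A H a h \<otimes>\<^bsub>tensor K A H\<^esub> tensor_elem K A H a' h'
        = tensor_elem K A H (a \<otimes>\<^bsub>A\<^esub> a') (h \<otimes>\<^bsub>H\<^esub> h')"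
proof -
  interpret A: assoc_algebra K A by (rule A)
  interpret H: assoc_algebra K H by (rule H)
  let ?T = "tensor K A H" and ?e = "tensor_elem K A H"
  have mA: "module K A" and mH: "module K H" using A H by (auto intro: assoc_algebra_module)
  interpret T: balanced_tensor K A H "carrier K" "\<lambda>m c. c \<odot>\<^bsub>A\<^esub> m" "\<lambda>c n. c \<odot>\<^bsub>H\<^esub> n" ?T ?e
    by (rule balanced_tensor_field[OF mA mH])
  note mT = T.module_T
  interpret TM: module K ?T by (rule mT)
  let ?G = "tensor_group A H (carrier K) (\<lambda>m c. c \<odot>\<^bsub>A\<^esub> m) (\<lambda>c n. c \<odot>\<^bsub>H\<^esub> n)"
  \<comment> \<open>\<open>f a h\<close> is the summand of the inner lift in the product \<open>X Y\<close>, and \<open>I a h Y\<close> is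
    \<open>(a \<otimes> h) Y\<close>.\<close>
  define f where "f a h = (\<lambda>a' h'. ?e (a \<otimes>\<^bsub>A\<^esub> a') (h \<otimes>\<^bsub>H\<^esub> h'))" for a h
  define I where "I a h = tensor_lift (add_monoid ?T) (f a h)" for a h
  note e = tensor_elem_bilinear[OF mA mH]
  have f: "bilinear_map K A H ?T (f a h)" if "a \<in> carrier A" "h \<in> carrier H" for a h
    unfolding f_def
    by (intro bilinear_map_compose_args[OF e] linear_map_mult_left A H that)
  have f_h: "(\<lambda>h. f a h m n) \<in> linear_maps K H ?T"
    if "a \<in> carrier A" "m \<in> carrier A" "n \<in> carrier H" for a m n
    unfolding f_def using that
    by (intro linear_maps_compose[OF linear_map_mult_right[OF H]] bilinear_mapD(1)[OF e]) auto
  have f_a: "(\<lambda>a. f a h m n) \<in> linear_maps K A ?T"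
    if "h \<in> carrier H" "m \<in> carrier A" "n \<in> carrier H" for h m n
    unfolding f_def using that
    by (intro linear_maps_compose[OF linear_map_mult_right[OF A], of _ "\<lambda>x. ?e x _"]
        bilinear_mapD(2)[OF e]) auto
  have I: "bilinear_map K A H ?T (\<lambda>a h. I a h Y)" if Y: "Y \<in> carrier ?T" for Y
    unfolding I_def
    by (rule bilinear_mapI)
       (rule tensor_lift_linear_parameter[OF mA mH mT _ _ _ Y], simp_all add: mA mH f f_a f_h)+
  have IG: "tensor_lift ?G (f a h) Y = I a h Y"
    if "a \<in> carrier A" "h \<in> carrier H" "Y \<in> carrier ?T" for a h Y
    unfolding I_def
    by (intro T.tensor_lift_tensor_group bilinear_map_balanced_linear[OF mA mH] f that)
  have J: "bilinear_map K A H ?T (\<lambda>a h. tensor_lift ?G (f a h) Y)" if Y: "Y \<in> carrier ?T" for Y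
    using I[OF Y] by (auto simp: bilinear_map_def linear_maps_def IG Y Pi_iff)
  have mult: "X \<otimes>\<^bsub>?T\<^esub> Y = tensor_lift (add_monoid ?T) (\<lambda>a h. I a h Y) X"
    if XY: "X \<in> carrier ?T" "Y \<in> carrier ?T" for X Y
  proof -
    have "X \<otimes>\<^bsub>?T\<^esub> Y = tensor_lift ?G (\<lambda>a h. tensor_lift ?G (f a h) Y) X"
      by (simp add: tensor_def f_def Let_def)
    also have "\<dots> = tensor_lift (add_monoid ?T) (\<lambda>a h. tensor_lift ?G (f a h) Y) X"
      by (intro T.tensor_lift_tensor_group bilinear_map_balanced_linear[OF mA mH] J XY)
    also have "\<dots> = tensor_lift (add_monoid ?T) (\<lambda>a h. I a h Y) X"
      by (rule tensor_lift_cong[OF mA mH mT J I]) (simp_all add: XY IG)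
    finally show ?thesis .
  qed
  have lin_right: "(\<lambda>Y. tensor_lift (add_monoid ?T) (\<lambda>a h. I a h Y) X) \<in> linear_maps K ?T ?T"
    if "X \<in> carrier ?T" for X
    by (rule tensor_lift_linear_parameter[OF mA mH mT mT I _ that])
       (auto simp: I_def intro: tensor_lift_linear[OF mA mH mT f])
  have bil: "bilinear_map K ?T ?T ?T (mult ?T)"
  proof (rule bilinear_mapI)
    fix X assume "X \<in> carrier ?T"
    with lin_right[OF this] show "(\<otimes>\<^bsub>?T\<^esub>) X \<in> linear_maps K ?T ?T"
      by (rule_tac linear_maps_cong[OF _ mT]) (auto simp: mult)
  next
    fix Y assume "Y \<in> carrier ?T"
    with tensor_lift_linear[OF mA mH mT I[OF this]] show "(\<lambda>X. X \<otimes>\<^bsub>?T\<^esub> Y) \<in> linear_maps K ?T ?T"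
      by (rule_tac linear_maps_cong[OF _ mT]) (auto simp: mult)
  qed
  note D = bilinear_mapD(3)[OF bil] linear_mapsD(2,3)[OF bilinear_mapD(1)[OF bil]]
    linear_mapsD(2,3)[OF bilinear_mapD(2)[OF bil]]
  show pure: "?e a h \<otimes>\<^bsub>?T\<^esub> ?e a' h' = ?e (a \<otimes>\<^bsub>A\<^esub> a') (h \<otimes>\<^bsub>H\<^esub> h')"
    if "a \<in> carrier A" "h \<in> carrier H" "a' \<in> carrier A" "h' \<in> carrier H" for a h a' h'
  proof -
    have Y: "?e a' h' \<in> carrier ?T" using that by (simp add: T.t_closed)
    have "?e a h \<otimes>\<^bsub>?T\<^esub> ?e a' h' = I a h (?e a' h')"
      using that Y by (simp add: mult T.t_closed tensor_lift_elem[OF mA mH mT I])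
    also have "\<dots> = f a h a' h'"
      unfolding I_def using that by (simp add: tensor_lift_elem[OF mA mH mT f])
    finally show ?thesis by (simp add: f_def)
  qed
  have one: "\<one>\<^bsub>?T\<^esub> = ?e \<one>\<^bsub>A\<^esub> \<one>\<^bsub>H\<^esub>" by (simp add: tensor_def Let_def)
  have assoc1: "?e a h \<otimes>\<^bsub>?T\<^esub> ?e a' h' \<otimes>\<^bsub>?T\<^esub> Z = ?e a h \<otimes>\<^bsub>?T\<^esub> (?e a' h' \<otimes>\<^bsub>?T\<^esub> Z)"
    if "a \<in> carrier A" "h \<in> carrier H" "a' \<in> carrier A" "h' \<in> carrier H" "Z \<in> carrier ?T"
    for a h a' h' Z
    using that(5) by (induction Z rule: T.T_induct)
      (simp_all add: that(1-4) pure T.t_closed A.m_assoc H.m_assoc D)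
  have assoc2: "?e a h \<otimes>\<^bsub>?T\<^esub> Y \<otimes>\<^bsub>?T\<^esub> Z = ?e a h \<otimes>\<^bsub>?T\<^esub> (Y \<otimes>\<^bsub>?T\<^esub> Z)"
    if "a \<in> carrier A" "h \<in> carrier H" "Y \<in> carrier ?T" "Z \<in> carrier ?T" for a h Y Z
    using that(3) by (induction Y rule: T.T_induct)
      (simp_all add: that(1,2,4) T.t_closed assoc1 D)
  have assoc: "X \<otimes>\<^bsub>?T\<^esub> Y \<otimes>\<^bsub>?T\<^esub> Z = X \<otimes>\<^bsub>?T\<^esub> (Y \<otimes>\<^bsub>?T\<^esub> Z)"
    if "X \<in> carrier ?T" "Y \<in> carrier ?T" "Z \<in> carrier ?T" for X Y Z
    using that(1) by (induction X rule: T.T_induct)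
      (simp_all add: that(2,3) T.t_closed assoc2 D)
  have one_l: "\<one>\<^bsub>?T\<^esub> \<otimes>\<^bsub>?T\<^esub> X = X" and one_r: "X \<otimes>\<^bsub>?T\<^esub> \<one>\<^bsub>?T\<^esub> = X" if "X \<in> carrier ?T" for X
    using that by (induction X rule: T.T_induct) (simp_all add: one pure D T.t_closed)
  have "monoid ?T"
    by (rule monoidI) (simp_all add: D assoc one_l one_r, simp add: one T.t_closed)
  then have "ring ?T"
    by (intro ringI TM.abelian_group_axioms) (simp_all add: D)
  then show "assoc_algebra K ?T"
    by (intro assoc_algebra.intro assoc_algebra_axioms.intro A.field_axioms mT) (simp_all add: D)
qed

section \<open>Subspaces are direct summands\<close>

text \<open>Additive inverses are multiples by \<open>- 1\<close>.\<close>

lemma (in module) submoduleI_no_inverse: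
  assumes "W \<subseteq> carrier M" "\<zero>\<^bsub>M\<^esub> \<in> W"
    and "\<And>a b. a \<in> W \<Longrightarrow> b \<in> W \<Longrightarrow> a \<oplus>\<^bsub>M\<^esub> b \<in> W"
    and "\<And>a x. a \<in> carrier R \<Longrightarrow> x \<in> W \<Longrightarrow> a \<odot>\<^bsub>M\<^esub> x \<in> W"
  shows "submodule W R M"
proof (rule submoduleI)
  fix a assume "a \<in> W"
  then have "\<ominus>\<^bsub>M\<^esub> a = (\<ominus> \<one>) \<odot>\<^bsub>M\<^esub> a"
    using assms(1) by (subst smult_l_minus) auto
  then show "\<ominus>\<^bsub>M\<^esub> a \<in> W" using \<open>a \<in> W\<close> assms(4) by simp
qed (use assms in auto)

text \<open>
  By Zorn's lemma there is a maximal subspace \<open>W\<close> that meets \<open>E\<close> trivially.  If \<open>x \<notin> E + W\<close>, then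
  \<open>W + K x\<close> still meets \<open>E\<close> trivially: from \<open>w + c x \<in> E\<close> with \<open>c \<noteq> 0\<close> one could solve for
  \<open>x\<close>.
\<close>

lemma submodule_complement:
  assumes K: "field K" and M: "module K M" and E: "submodule E K M"
  obtains W where "submodule W K M" "W \<inter> E = {\<zero>\<^bsub>M\<^esub>}"
    "\<And>x. x \<in> carrier M \<Longrightarrow> \<exists>e\<in>E. \<exists>w\<in>W. x = e \<oplus>\<^bsub>M\<^esub> w"
proof -
  interpret K: field K by (rule K)
  interpret M: module K M by (rule M)
  define F where "F = {W. submodule W K M \<and> W \<inter> E = {\<zero>\<^bsub>M\<^esub>}}"
  note sub = M.submoduleE
  have zero: "\<zero>\<^bsub>M\<^esub> \<in> W" if "submodule W K M" for W
    using subgroup.one_closed[OF submodule.axioms(1)[OF that]] by simp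
  have "{\<zero>\<^bsub>M\<^esub>} \<in> F"
    unfolding F_def using zero[OF E] by (auto intro!: M.submoduleI_no_inverse)
  then have "F \<noteq> {}" by blast
  moreover have "\<Union>C \<in> F" if C: "C \<noteq> {}" "subset.chain F C" for C
  proof -
    have CF: "W \<in> F" if "W \<in> C" for W using C(2) that by (auto simp: subset_chain_def)
    have "submodule (\<Union>C) K M"
    proof (rule M.submoduleI_no_inverse)
      fix a b assume "a \<in> \<Union>C" "b \<in> \<Union>C"
      then obtain V W where VW: "V \<in> C" "W \<in> C" "a \<in> V" "b \<in> W" by blast
      then have "V \<subseteq> W \<or> W \<subseteq> V" using C(2) by (auto simp: subset_chain_def)
      then obtain U where "U \<in> C" "a \<in> U" "b \<in> U" using VW by blast
      then show "a \<oplus>\<^bsub>M\<^esub> b \<in> \<Union>C"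
        using CF[of U] sub(5)[of U a b] by (auto simp: F_def)
    next
      fix a x assume "a \<in> carrier K" "x \<in> \<Union>C"
      then obtain W where "W \<in> C" "x \<in> W" "submodule W K M" using CF by (auto simp: F_def)
      then show "a \<odot>\<^bsub>M\<^esub> x \<in> \<Union>C" using sub(4) \<open>a \<in> carrier K\<close> by blast
    qed (use C(1) CF sub(1) zero in \<open>auto simp: F_def\<close>)
    then show ?thesis using C(1) CF by (auto simp: F_def)
  qed
  ultimately obtain W where W: "W \<in> F" and max: "\<And>V. V \<in> F \<Longrightarrow> W \<subseteq> V \<Longrightarrow> V = W"
    using subset_Zorn_nonempty[of F] by blast
  have sW: "submodule W K M" and WE: "W \<inter> E = {\<zero>\<^bsub>M\<^esub>}" using W by (auto simp: F_def)
  have cW: "w \<in> carrier M" if "w \<in> W" for w using sub(1)[OF sW] that by blast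
  have cE: "w \<in> carrier M" if "w \<in> E" for w using sub(1)[OF E] that by blast
  have "\<exists>e\<in>E. \<exists>w\<in>W. x = e \<oplus>\<^bsub>M\<^esub> w" if x: "x \<in> carrier M" for x
  proof (rule ccontr)
    assume no: "\<not> ?thesis"
    define V where "V = {w \<oplus>\<^bsub>M\<^esub> c \<odot>\<^bsub>M\<^esub> x | w c. w \<in> W \<and> c \<in> carrier K}"
    have VI: "w \<oplus>\<^bsub>M\<^esub> c \<odot>\<^bsub>M\<^esub> x \<in> V" if "w \<in> W" "c \<in> carrier K" for w c
      using that by (auto simp: V_def)
    have WV: "w \<in> V" if "w \<in> W" for w
      using VI[OF that K.zero_closed] cW[OF that] x by simp
    have "submodule V K M"
    proof (rule M.submoduleI_no_inverse)
      show "V \<subseteq> carrier M" using cW x by (auto simp: V_def)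
      show "\<zero>\<^bsub>M\<^esub> \<in> V" by (rule WV[OF zero[OF sW]])
    next
      fix a b assume "a \<in> V" "b \<in> V"
      then obtain w c w' c' where *: "a = w \<oplus>\<^bsub>M\<^esub> c \<odot>\<^bsub>M\<^esub> x" "b = w' \<oplus>\<^bsub>M\<^esub> c' \<odot>\<^bsub>M\<^esub> x"
        "w \<in> W" "c \<in> carrier K" "w' \<in> W" "c' \<in> carrier K" by (auto simp: V_def)
      then have "a \<oplus>\<^bsub>M\<^esub> b = (w \<oplus>\<^bsub>M\<^esub> w') \<oplus>\<^bsub>M\<^esub> (c \<oplus>\<^bsub>K\<^esub> c') \<odot>\<^bsub>M\<^esub> x"
        using cW x by (simp add: M.smult_l_distr M.a_ac)
      also have "\<dots> \<in> V" using * sub(5)[OF sW] by (intro VI) auto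
      finally show "a \<oplus>\<^bsub>M\<^esub> b \<in> V" .
    next
      fix a y assume a: "a \<in> carrier K" and "y \<in> V"
      then obtain w c where *: "y = w \<oplus>\<^bsub>M\<^esub> c \<odot>\<^bsub>M\<^esub> x" "w \<in> W" "c \<in> carrier K"
        by (auto simp: V_def)
      then have "a \<odot>\<^bsub>M\<^esub> y = a \<odot>\<^bsub>M\<^esub> w \<oplus>\<^bsub>M\<^esub> (a \<otimes>\<^bsub>K\<^esub> c) \<odot>\<^bsub>M\<^esub> x"
        using cW x a by (simp add: M.smult_r_distr M.smult_assoc1)
      also have "\<dots> \<in> V" using * a sub(4)[OF sW] by (intro VI) auto
      finally show "a \<odot>\<^bsub>M\<^esub> y \<in> V" .
    qed
    moreover have V0: "y = \<zero>\<^bsub>M\<^esub>" if y: "y \<in> V" "y \<in> E" for y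
    proof -
      obtain w c where *: "y = w \<oplus>\<^bsub>M\<^esub> c \<odot>\<^bsub>M\<^esub> x" "w \<in> W" "c \<in> carrier K"
        using y(1) by (auto simp: V_def)
      have "c = \<zero>\<^bsub>K\<^esub>"
      proof (rule ccontr)
        assume "c \<noteq> \<zero>\<^bsub>K\<^esub>"
        then have u: "c \<in> Units K" using *(3) by (simp add: K.field_Units)
        let ?d = "inv\<^bsub>K\<^esub> c"
        have d: "?d \<in> carrier K" "?d \<otimes>\<^bsub>K\<^esub> c = \<one>\<^bsub>K\<^esub>" using u by auto
        have "?d \<odot>\<^bsub>M\<^esub> y = ?d \<odot>\<^bsub>M\<^esub> w \<oplus>\<^bsub>M\<^esub> x"
          using * d x cW by (simp add: M.smult_r_distr M.smult_assoc1[symmetric])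
        then have "?d \<odot>\<^bsub>M\<^esub> y \<oplus>\<^bsub>M\<^esub> \<ominus>\<^bsub>M\<^esub> (?d \<odot>\<^bsub>M\<^esub> w)
            = x \<oplus>\<^bsub>M\<^esub> (?d \<odot>\<^bsub>M\<^esub> w \<oplus>\<^bsub>M\<^esub> \<ominus>\<^bsub>M\<^esub> (?d \<odot>\<^bsub>M\<^esub> w))"
          using x d(1) cW[OF *(2)] by (simp add: M.a_ac)
        then have "x = ?d \<odot>\<^bsub>M\<^esub> y \<oplus>\<^bsub>M\<^esub> \<ominus>\<^bsub>M\<^esub> (?d \<odot>\<^bsub>M\<^esub> w)"
          using x d(1) cW[OF *(2)] by (simp add: M.r_neg)
        moreover have "?d \<odot>\<^bsub>M\<^esub> y \<in> E" using sub(4)[OF E] d y by blast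
        moreover have "\<ominus>\<^bsub>M\<^esub> (?d \<odot>\<^bsub>M\<^esub> w) \<in> W" using sub(3,4)[OF sW] d *(2) by blast
        ultimately show False using no by blast
      qed
      then have "y = w" using * cW x by simp
      then show ?thesis using WE y(2) *(2) by blast
    qed
    moreover have "V \<inter> E = {\<zero>\<^bsub>M\<^esub>}"
      using V0 WV[OF zero[OF sW]] zero[OF E] by blast
    ultimately have "V \<in> F" by (simp add: F_def)
    moreover have "W \<subseteq> V" using WV by blast
    ultimately have "V = W" by (rule max)
    moreover have "x \<in> V" using VI[OF zero[OF sW] K.one_closed] x by simp
    ultimately have "x \<in> W" by simp
    moreover have "x = \<zero>\<^bsub>M\<^esub> \<oplus>\<^bsub>M\<^esub> x" using x by simp
    ultimately show False using no zero[OF E] by blast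
  qed
  then show ?thesis using that[OF sW WE] by blast
qed

lemma submodule_retraction:
  assumes K: "field K" and M: "module K M" and E: "submodule E K M"
  obtains p where "p \<in> linear_maps K M (M\<lparr>carrier := E\<rparr>)" "\<And>x. x \<in> E \<Longrightarrow> p x = x"
proof -
  interpret M: module K M by (rule M)
  obtain W where sW: "submodule W K M" and WE: "W \<inter> E = {\<zero>\<^bsub>M\<^esub>}"
    and ex: "\<And>x. x \<in> carrier M \<Longrightarrow> \<exists>e\<in>E. \<exists>w\<in>W. x = e \<oplus>\<^bsub>M\<^esub> w"
    using submodule_complement[OF assms] by metis
  note subW = M.submoduleE[OF sW] and subE = M.submoduleE[OF E]
  have uniq: "e = e'" if "e \<in> E" "e' \<in> E" "w \<in> W" "w' \<in> W" "e \<oplus>\<^bsub>M\<^esub> w = e' \<oplus>\<^bsub>M\<^esub> w'" for e e' w w'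
  proof -
    have c: "e \<in> carrier M" "e' \<in> carrier M" "w \<in> carrier M" "w' \<in> carrier M"
      using that subE(1) subW(1) by auto
    have "e \<oplus>\<^bsub>M\<^esub> \<ominus>\<^bsub>M\<^esub> e' = (e \<oplus>\<^bsub>M\<^esub> w) \<oplus>\<^bsub>M\<^esub> \<ominus>\<^bsub>M\<^esub> w \<oplus>\<^bsub>M\<^esub> \<ominus>\<^bsub>M\<^esub> e'"
      using c by (simp add: M.a_assoc M.r_neg)
    also have "\<dots> = (w' \<oplus>\<^bsub>M\<^esub> \<ominus>\<^bsub>M\<^esub> w) \<oplus>\<^bsub>M\<^esub> (e' \<oplus>\<^bsub>M\<^esub> \<ominus>\<^bsub>M\<^esub> e')"
      unfolding that(5) using c by (simp add: M.a_ac)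
    also have "\<dots> = w' \<oplus>\<^bsub>M\<^esub> \<ominus>\<^bsub>M\<^esub> w" using c by (simp add: M.r_neg)
    finally have eq: "e \<oplus>\<^bsub>M\<^esub> \<ominus>\<^bsub>M\<^esub> e' = w' \<oplus>\<^bsub>M\<^esub> \<ominus>\<^bsub>M\<^esub> w" .
    moreover have "e \<oplus>\<^bsub>M\<^esub> \<ominus>\<^bsub>M\<^esub> e' \<in> E" "w' \<oplus>\<^bsub>M\<^esub> \<ominus>\<^bsub>M\<^esub> w \<in> W"
      using that subE(3,5) subW(3,5) by auto
    ultimately have "e \<oplus>\<^bsub>M\<^esub> \<ominus>\<^bsub>M\<^esub> e' = \<zero>\<^bsub>M\<^esub>" using WE by auto
    then show ?thesis using c M.minus_equality[of e "\<ominus>\<^bsub>M\<^esub> e'"] by simp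
  qed
  define p where "p x = (THE e. e \<in> E \<and> (\<exists>w\<in>W. x = e \<oplus>\<^bsub>M\<^esub> w))" for x
  have pI: "p (e \<oplus>\<^bsub>M\<^esub> w) = e" if "e \<in> E" "w \<in> W" for e w
    unfolding p_def using that uniq by (intro the_equality) blast+
  show ?thesis
  proof (rule that)
    show "p \<in> linear_maps K M (M\<lparr>carrier := E\<rparr>)"
    proof (rule linear_mapsI)
      fix x assume "x \<in> carrier M"
      then show "p x \<in> carrier (M\<lparr>carrier := E\<rparr>)" using ex pI by force
    next
      fix x y assume "x \<in> carrier M" "y \<in> carrier M"
      then obtain e w e' w' where *: "e \<in> E" "w \<in> W" "x = e \<oplus>\<^bsub>M\<^esub> w"
        "e' \<in> E" "w' \<in> W" "y = e' \<oplus>\<^bsub>M\<^esub> w'" using ex by meson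
      then have c: "e \<in> carrier M" "e' \<in> carrier M" "w \<in> carrier M" "w' \<in> carrier M"
        using subE(1) subW(1) by auto
      have "x \<oplus>\<^bsub>M\<^esub> y = (e \<oplus>\<^bsub>M\<^esub> e') \<oplus>\<^bsub>M\<^esub> (w \<oplus>\<^bsub>M\<^esub> w')" using c * by (simp add: M.a_ac)
      then show "p (x \<oplus>\<^bsub>M\<^esub> y) = p x \<oplus>\<^bsub>M\<lparr>carrier := E\<rparr>\<^esub> p y"
        using * subE(5) subW(5) by (simp add: pI)
    next
      fix c x assume c: "c \<in> carrier K" and "x \<in> carrier M"
      then obtain e w where *: "e \<in> E" "w \<in> W" "x = e \<oplus>\<^bsub>M\<^esub> w" using ex by meson
      then have "c \<odot>\<^bsub>M\<^esub> x = c \<odot>\<^bsub>M\<^esub> e \<oplus>\<^bsub>M\<^esub> c \<odot>\<^bsub>M\<^esub> w"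
        using c subsetD[OF subE(1)] subsetD[OF subW(1)] by (simp add: M.smult_r_distr)
      then show "p (c \<odot>\<^bsub>M\<^esub> x) = c \<odot>\<^bsub>M\<lparr>carrier := E\<rparr>\<^esub> p x"
        using * c subE(4) subW(4) by (simp add: pI)
    qed
  next
    fix x assume x: "x \<in> E"
    have "\<zero>\<^bsub>M\<^esub> \<in> W" using WE by blast
    from pI[OF x this] show "p x = x" using x subE(1) by auto
  qed
qed

text \<open>
  A retraction onto the subspace, tensored with \<open>N\<close>, is a left inverse of the induced map of
  tensor products.
\<close>

lemma tensor_map_submodule_inj:
  assumes K: "field K" and M: "module K M" and N: "module K N" and E: "submodule E K M"
  shows "inj_on (tensor_map K M N (\<lambda>x. x) (\<lambda>x. x)) (carrier (tensor K (M\<lparr>carrier := E\<rparr>) N))"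
proof -
  let ?E = "M\<lparr>carrier := E\<rparr>"
  have mE: "module K ?E" by (rule submodule.submodule_is_module[OF E M])
  have sub: "E \<subseteq> carrier M" by (rule module.submoduleE(1)[OF M E])
  have i: "(\<lambda>x. x) \<in> linear_maps K ?E M" using sub by (auto simp: linear_maps_def)
  obtain p where p: "p \<in> linear_maps K M ?E" "\<And>x. x \<in> E \<Longrightarrow> p x = x"
    using submodule_retraction[OF K M E] by metis
  note idN = linear_maps_id[of K N]
  have "tensor_map K ?E N p (\<lambda>x. x) (tensor_map K M N (\<lambda>x. x) (\<lambda>x. x) U) = U"
    if "U \<in> carrier (tensor K ?E N)" for U
    by (rule tensor_linear_maps_eqI[OF mE N linear_maps_compose[OF
          tensor_map_linear[OF mE N M N i idN] tensor_map_linear[OF M N mE N p(1) idN]]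
          linear_maps_id that])
       (use sub in \<open>auto simp: tensor_map_elem[OF mE N M N i idN]
          tensor_map_elem[OF M N mE N p(1) idN] p(2)\<close>)
  then show ?thesis by (rule inj_on_inverseI)
qed

section \<open>The canonical map\<close>

lemma linear_maps_inv_into:
  assumes M: "module K M" and f: "f \<in> linear_maps K M N"
    and bij: "bij_betw f (carrier M) (carrier N)"
  shows "inv_into (carrier M) f \<in> linear_maps K N M"
proof -
  interpret M: module K M by (rule M)
  let ?g = "inv_into (carrier M) f"
  have g: "?g y \<in> carrier M" "f (?g y) = y" if "y \<in> carrier N" for y
    using bij that by (auto simp: bij_betw_def inv_into_into f_inv_into_f)
  have eq: "?g (f x) = x" if "x \<in> carrier M" for x
    using bij that by (simp add: bij_betw_def inv_into_f_f)
  show ?thesis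
  proof (rule linear_mapsI)
    fix x y assume "x \<in> carrier N" "y \<in> carrier N"
    then show "?g (x \<oplus>\<^bsub>N\<^esub> y) = ?g x \<oplus>\<^bsub>M\<^esub> ?g y"
      using eq[of "?g x \<oplus>\<^bsub>M\<^esub> ?g y"] by (simp add: g linear_mapsD(2)[OF f])
  next
    fix c y assume "c \<in> carrier K" "y \<in> carrier N"
    then show "?g (c \<odot>\<^bsub>N\<^esub> y) = c \<odot>\<^bsub>M\<^esub> ?g y"
      using eq[of "c \<odot>\<^bsub>M\<^esub> ?g y"] by (simp add: g linear_mapsD(3)[OF f])
  qed (rule g)
qed

context comodule_algebra
begin

abbreviation "B \<equiv> coinvariants K H A \<rho>"
abbreviation "T \<equiv> tensor_over B A"
abbreviation "t \<equiv> tensor_elem_over B A"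
abbreviation "AH \<equiv> tensor K A H"
abbreviation "e \<equiv> tensor_elem K A H"
abbreviation "can \<equiv> canonical_map K H A \<rho>"
abbreviation "E \<equiv> tensor_centralizer B A"
abbreviation "TH \<equiv> tensor K T H"

lemma algebra_A: "assoc_algebra K A" and algebra_H: "assoc_algebra K H"
  by unfold_locales

lemmas module_A = assoc_algebra_module[OF algebra_A]
lemmas module_H = assoc_algebra_module[OF algebra_H]
lemmas algebra_AH = assoc_algebra_tensor[OF algebra_A algebra_H]
lemmas module_AH = module_tensor[OF module_A module_H]
lemmas e_mult = tensor_elem_mult[OF algebra_A algebra_H]
lemmas bilinear_e = tensor_elem_bilinear[OF module_A module_H]
lemmas e_closed = bilinear_mapD(3)[OF bilinear_e]

interpretation AH: assoc_algebra K AH by (rule algebra_AH)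

lemma coaction_closed: "a \<in> carrier A \<Longrightarrow> \<rho> a \<in> carrier AH"
  and coaction_mult: "a \<in> carrier A \<Longrightarrow> b \<in> carrier A \<Longrightarrow> \<rho> (a \<otimes>\<^bsub>A\<^esub> b) = \<rho> a \<otimes>\<^bsub>AH\<^esub> \<rho> b"
  and coaction_one: "\<rho> \<one>\<^bsub>A\<^esub> = \<one>\<^bsub>AH\<^esub>"
  using coaction_ring_hom by (auto simp: ring_hom_def)

lemma one_AH: "\<one>\<^bsub>AH\<^esub> = e \<one>\<^bsub>A\<^esub> \<one>\<^bsub>H\<^esub>"
  by (simp add: tensor_def Let_def)

lemma B_closed: "b \<in> B \<Longrightarrow> b \<in> carrier A"
  and coaction_B: "b \<in> B \<Longrightarrow> \<rho> b = e b \<one>\<^bsub>H\<^esub>"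
  by (simp_all add: coinvariants_def)

lemma scalar_in_B:
  assumes "c \<in> carrier K" shows "c \<odot>\<^bsub>A\<^esub> \<one>\<^bsub>A\<^esub> \<in> B"
  using assms linear_mapsD(3)[OF coaction_linear, of c "\<one>\<^bsub>A\<^esub>"]
    linear_mapsD(3)[OF bilinear_mapD(2)[OF bilinear_e], of "\<one>\<^bsub>H\<^esub>" c "\<one>\<^bsub>A\<^esub>"]
  by (simp add: coinvariants_def coaction_one one_AH)

lemma balanced_tensor_over:
  "balanced_tensor K A A B (\<lambda>a b. a \<otimes>\<^bsub>A\<^esub> b) (\<lambda>b a. b \<otimes>\<^bsub>A\<^esub> a) T t"
  by unfold_locales
     (simp_all add: B_closed A.smult_mult_left tensor_over_def tensor_elem_over_def Let_def)

interpretation T: balanced_tensor K A A B "\<lambda>a b. a \<otimes>\<^bsub>A\<^esub> b" "\<lambda>b a. b \<otimes>\<^bsub>A\<^esub> a" T t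
  by (rule balanced_tensor_over)

lemmas module_T = T.module_T
lemmas module_TH = module_tensor[OF module_T module_H]

lemma one_T: "\<one>\<^bsub>T\<^esub> = t \<one>\<^bsub>A\<^esub> \<one>\<^bsub>A\<^esub>"
  by (simp add: tensor_over_def Let_def)

text \<open>
  Scalars may cross the tensor sign of \<open>A \<otimes>\<^sub>B A\<close> because \<open>K 1 \<subseteq> B\<close>.
\<close>

lemma t_smult_right:
  assumes "c \<in> carrier K" "a \<in> carrier A" "a' \<in> carrier A"
  shows "t a (c \<odot>\<^bsub>A\<^esub> a') = c \<odot>\<^bsub>T\<^esub> t a a'"
proof -
  have "t a (c \<odot>\<^bsub>A\<^esub> a') = t a ((c \<odot>\<^bsub>A\<^esub> \<one>\<^bsub>A\<^esub>) \<otimes>\<^bsub>A\<^esub> a')"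
    using assms by (simp add: A.smult_mult_left)
  also have "\<dots> = t (a \<otimes>\<^bsub>A\<^esub> (c \<odot>\<^bsub>A\<^esub> \<one>\<^bsub>A\<^esub>)) a'"
    using assms scalar_in_B by (simp add: T.t_balanced)
  finally show ?thesis using assms by (simp add: A.smult_mult_right T.t_smult)
qed

lemma bilinear_t: "bilinear_map K A A T t"
  by (intro bilinear_mapI linear_mapsI)
     (simp_all add: T.t_closed T.t_add_left T.t_add_right T.t_smult t_smult_right)

lemma balanced_can: "T.balanced_linear AH (\<lambda>a a'. e a \<one>\<^bsub>H\<^esub> \<otimes>\<^bsub>AH\<^esub> \<rho> a')"
proof (rule T.balanced_linearI)
  fix a' assume "a' \<in> carrier A"
  then show "(\<lambda>a. e a \<one>\<^bsub>H\<^esub> \<otimes>\<^bsub>AH\<^esub> \<rho> a') \<in> linear_maps K A AH"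
    by (intro linear_maps_compose[OF bilinear_mapD(2)[OF bilinear_e], of _ "\<lambda>x. x \<otimes>\<^bsub>AH\<^esub> \<rho> a'"]
        linear_map_mult_right[OF algebra_AH] coaction_closed) auto
next
  fix a x y assume "a \<in> carrier A" "x \<in> carrier A" "y \<in> carrier A"
  then show "e a \<one>\<^bsub>H\<^esub> \<otimes>\<^bsub>AH\<^esub> \<rho> (x \<oplus>\<^bsub>A\<^esub> y)
      = e a \<one>\<^bsub>H\<^esub> \<otimes>\<^bsub>AH\<^esub> \<rho> x \<oplus>\<^bsub>AH\<^esub> e a \<one>\<^bsub>H\<^esub> \<otimes>\<^bsub>AH\<^esub> \<rho> y"
    by (simp add: linear_mapsD(2)[OF coaction_linear] AH.r_distr e_closed coaction_closed)
next
  fix a b a' assume *: "a \<in> carrier A" "b \<in> B" "a' \<in> carrier A"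
  then have "e (a \<otimes>\<^bsub>A\<^esub> b) \<one>\<^bsub>H\<^esub> = e a \<one>\<^bsub>H\<^esub> \<otimes>\<^bsub>AH\<^esub> \<rho> b"
    by (simp add: coaction_B B_closed e_mult)
  then show "e (a \<otimes>\<^bsub>A\<^esub> b) \<one>\<^bsub>H\<^esub> \<otimes>\<^bsub>AH\<^esub> \<rho> a' = e a \<one>\<^bsub>H\<^esub> \<otimes>\<^bsub>AH\<^esub> \<rho> (b \<otimes>\<^bsub>A\<^esub> a')"
    using * by (simp add: coaction_mult B_closed AH.m_assoc e_closed coaction_closed)
qed

lemma tensor_lift_mult_left:
  assumes a: "a \<in> carrier A" and V: "V \<in> carrier AH"
  shows "tensor_lift (add_monoid AH) (\<lambda>x h. e (a \<otimes>\<^bsub>A\<^esub> x) h) V = e a \<one>\<^bsub>H\<^esub> \<otimes>\<^bsub>AH\<^esub> V"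
proof -
  have b: "bilinear_map K A H AH (\<lambda>x h. e (a \<otimes>\<^bsub>A\<^esub> x) h)"
    by (rule bilinear_map_compose_args[OF bilinear_e linear_map_mult_left[OF algebra_A a]
          linear_maps_id])
  show ?thesis
    by (rule tensor_linear_maps_eqI[OF module_A module_H
          tensor_lift_linear[OF module_A module_H module_AH b]
          linear_map_mult_left[OF algebra_AH e_closed] V])
       (simp_all add: tensor_lift_elem[OF module_A module_H module_AH b] e_mult a)
qed

text \<open>
  With the canonical map written as a product in \<open>A \<otimes> H\<close>, ring computations replace
  computations with Sweedler sums.
\<close>

lemma can_eq:
  assumes X: "X \<in> carrier T"
  shows "can X = tensor_lift (add_monoid AH) (\<lambda>a a'. e a \<one>\<^bsub>H\<^esub> \<otimes>\<^bsub>AH\<^esub> \<rho> a') X"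
  unfolding canonical_map_def Let_def
  by (rule T.lift_cong[OF module_AH balanced_can X]) (simp add: tensor_lift_mult_left coaction_closed)

lemma can_linear: "can \<in> linear_maps K T AH"
  by (rule linear_maps_cong[OF T.lift_linear[OF module_AH balanced_can] module_T]) (rule can_eq)

lemma can_t: "a \<in> carrier A \<Longrightarrow> a' \<in> carrier A \<Longrightarrow> can (t a a') = e a \<one>\<^bsub>H\<^esub> \<otimes>\<^bsub>AH\<^esub> \<rho> a'"
  by (simp add: can_eq T.t_closed T.lift_t[OF module_AH balanced_can])

text \<open>
  The bimodule action \<open>X \<mapsto> a X a'\<close> on \<open>A \<otimes>\<^sub>B A\<close>.  Both the \<open>B\<close>-centrality condition and the
  product of \<open>(A \<otimes>\<^sub>B A)\<^sup>B\<close>, which is \<open>(a \<otimes> a') Y = a Y a'\<close>, are instances of it.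
\<close>

definition sandwich where
  "sandwich a a' = tensor_lift (add_monoid T) (\<lambda>x y. t (a \<otimes>\<^bsub>A\<^esub> x) (y \<otimes>\<^bsub>A\<^esub> a'))"

lemma balanced_sandwich:
  assumes a: "a \<in> carrier A" "a' \<in> carrier A"
  shows "T.balanced_linear T (\<lambda>x y. t (a \<otimes>\<^bsub>A\<^esub> x) (y \<otimes>\<^bsub>A\<^esub> a'))"
proof (rule T.balanced_linearI)
  fix y assume "y \<in> carrier A"
  then show "(\<lambda>x. t (a \<otimes>\<^bsub>A\<^esub> x) (y \<otimes>\<^bsub>A\<^esub> a')) \<in> linear_maps K A T"
    using a by (intro linear_maps_compose[OF linear_map_mult_left[OF algebra_A],
          of _ "\<lambda>x. t x (y \<otimes>\<^bsub>A\<^esub> a')"] bilinear_mapD(2)[OF bilinear_t]) auto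
next
  fix x b y assume "x \<in> carrier A" "b \<in> B" "y \<in> carrier A"
  then show "t (a \<otimes>\<^bsub>A\<^esub> (x \<otimes>\<^bsub>A\<^esub> b)) (y \<otimes>\<^bsub>A\<^esub> a') = t (a \<otimes>\<^bsub>A\<^esub> x) (b \<otimes>\<^bsub>A\<^esub> y \<otimes>\<^bsub>A\<^esub> a')"
    using a by (simp add: A.m_assoc[symmetric] B_closed T.t_balanced)
qed (use a in \<open>simp add: A.l_distr T.t_add_right\<close>)

lemma sandwich_linear:
  "a \<in> carrier A \<Longrightarrow> a' \<in> carrier A \<Longrightarrow> sandwich a a' \<in> linear_maps K T T"
  unfolding sandwich_def by (rule T.lift_linear[OF module_T balanced_sandwich])

lemma sandwich_t:
  assumes "a \<in> carrier A" "a' \<in> carrier A" "x \<in> carrier A" "y \<in> carrier A"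
  shows "sandwich a a' (t x y) = t (a \<otimes>\<^bsub>A\<^esub> x) (y \<otimes>\<^bsub>A\<^esub> a')"
  unfolding sandwich_def using assms by (simp add: T.lift_t[OF module_T balanced_sandwich])

lemma sandwich_sandwich:
  assumes "a \<in> carrier A" "a' \<in> carrier A" "b \<in> carrier A" "b' \<in> carrier A" "X \<in> carrier T"
  shows "sandwich a a' (sandwich b b' X) = sandwich (a \<otimes>\<^bsub>A\<^esub> b) (b' \<otimes>\<^bsub>A\<^esub> a') X"
  by (rule T.linear_maps_eqI[OF linear_maps_compose[OF sandwich_linear sandwich_linear]
        sandwich_linear])
     (use assms in \<open>simp_all add: sandwich_t A.m_assoc\<close>)

lemma bilinear_sandwich:
  assumes X: "X \<in> carrier T"
  shows "bilinear_map K A A T (\<lambda>a a'. sandwich a a' X)"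
  unfolding sandwich_def
proof (rule bilinear_mapI)
  fix a assume a: "a \<in> carrier A"
  show "(\<lambda>a'. tensor_lift (add_monoid T) (\<lambda>x y. t (a \<otimes>\<^bsub>A\<^esub> x) (y \<otimes>\<^bsub>A\<^esub> a')) X)
      \<in> linear_maps K A T"
  proof (rule T.lift_linear_parameter[OF module_T module_A balanced_sandwich[OF a] _ X])
    fix x y assume "x \<in> carrier A" "y \<in> carrier A"
    then show "(\<lambda>a'. t (a \<otimes>\<^bsub>A\<^esub> x) (y \<otimes>\<^bsub>A\<^esub> a')) \<in> linear_maps K A T"
      using a by (intro linear_maps_compose[OF linear_map_mult_left[OF algebra_A]]
          bilinear_mapD(1)[OF bilinear_t]) auto
  qed
next
  fix a' assume a': "a' \<in> carrier A"
  show "(\<lambda>a. tensor_lift (add_monoid T) (\<lambda>x y. t (a \<otimes>\<^bsub>A\<^esub> x) (y \<otimes>\<^bsub>A\<^esub> a')) X)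
      \<in> linear_maps K A T"
  proof (rule T.lift_linear_parameter[OF module_T module_A balanced_sandwich[OF _ a'] _ X])
    fix x y assume "x \<in> carrier A" "y \<in> carrier A"
    then show "(\<lambda>a. t (a \<otimes>\<^bsub>A\<^esub> x) (y \<otimes>\<^bsub>A\<^esub> a')) \<in> linear_maps K A T"
      using a' by (intro linear_maps_compose[OF linear_map_mult_right[OF algebra_A],
            of _ "\<lambda>z. t z (y \<otimes>\<^bsub>A\<^esub> a')"] bilinear_mapD(2)[OF bilinear_t]) auto
  qed
qed

lemma can_sandwich:
  assumes "a \<in> carrier A" "a' \<in> carrier A" "X \<in> carrier T"
  shows "can (sandwich a a' X) = e a \<one>\<^bsub>H\<^esub> \<otimes>\<^bsub>AH\<^esub> can X \<otimes>\<^bsub>AH\<^esub> \<rho> a'"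
proof (rule T.linear_maps_eqI[OF linear_maps_compose[OF sandwich_linear can_linear] _ assms(3)])
  show "(\<lambda>X. e a \<one>\<^bsub>H\<^esub> \<otimes>\<^bsub>AH\<^esub> can X \<otimes>\<^bsub>AH\<^esub> \<rho> a') \<in> linear_maps K T AH"
    using assms by (intro linear_maps_compose[OF linear_maps_compose[OF can_linear
        linear_map_mult_left[OF algebra_AH]] linear_map_mult_right[OF algebra_AH]]
        e_closed coaction_closed) auto
next
  fix x y assume xy: "x \<in> carrier A" "y \<in> carrier A"
  have "e (a \<otimes>\<^bsub>A\<^esub> x) \<one>\<^bsub>H\<^esub> = e a \<one>\<^bsub>H\<^esub> \<otimes>\<^bsub>AH\<^esub> e x \<one>\<^bsub>H\<^esub>"
    using assms xy by (simp add: e_mult)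
  then show "can (sandwich a a' (t x y)) = e a \<one>\<^bsub>H\<^esub> \<otimes>\<^bsub>AH\<^esub> can (t x y) \<otimes>\<^bsub>AH\<^esub> \<rho> a'"
    using assms xy
    by (simp add: sandwich_t can_t coaction_mult AH.m_assoc e_closed coaction_closed)
qed (use assms in auto)

section \<open>The centralizer of the coinvariants\<close>

lemma carrier_E:
  "carrier E = {X \<in> carrier T. \<forall>b\<in>B. sandwich b \<one>\<^bsub>A\<^esub> X = sandwich \<one>\<^bsub>A\<^esub> b X}"
proof -
  have "tensor_lift (add_monoid T) (\<lambda>a a'. t (b \<otimes>\<^bsub>A\<^esub> a) a') X = sandwich b \<one>\<^bsub>A\<^esub> X"
    and "tensor_lift (add_monoid T) (\<lambda>a a'. t a (a' \<otimes>\<^bsub>A\<^esub> b)) X = sandwich \<one>\<^bsub>A\<^esub> b X"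
    if "X \<in> carrier T" "b \<in> B" for X b
    unfolding sandwich_def using that
    by (simp_all add: T.lift_cong[OF module_T balanced_sandwich] B_closed)
  then show ?thesis by (auto simp: tensor_centralizer_def Let_def)
qed

lemma E_eq: "E = T\<lparr>carrier := carrier E\<rparr>"
  by (simp add: tensor_centralizer_def Let_def)

lemma ops_E: "add E = add T" "mult E = mult T" "smult E = smult T" "\<one>\<^bsub>E\<^esub> = \<one>\<^bsub>T\<^esub>"
  by (simp_all add: tensor_centralizer_def Let_def)

lemma submodule_E: "submodule (carrier E) K T"
proof -
  interpret TM: module K T by (rule module_T)
  have z: "f \<zero>\<^bsub>T\<^esub> = \<zero>\<^bsub>T\<^esub>" if "f \<in> linear_maps K T T" for f
    using linear_mapsD(1)[OF that, of "\<zero>\<^bsub>T\<^esub>"] linear_mapsD(3)[OF that, of "\<zero>\<^bsub>K\<^esub>" "\<zero>\<^bsub>T\<^esub>"] by simp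
  show ?thesis
    by (rule TM.submoduleI_no_inverse)
       (auto simp: carrier_E B_closed z[OF sandwich_linear]
         linear_mapsD(2,3)[OF sandwich_linear])
qed

lemma module_E: "module K E"
  by (subst E_eq) (rule submodule.submodule_is_module[OF submodule_E module_T])

text \<open>
  \<open>B\<close>-centrality of \<open>Y\<close> is what makes \<open>(a \<otimes> a') Y\<close> independent of representatives:
  \<open>(a b) Y a' = a (b Y) a' = a (Y b) a' = a Y (b a')\<close>.
\<close>

lemma balanced_mult:
  assumes Y: "Y \<in> carrier E"
  shows "T.balanced_linear T (\<lambda>a a'. sandwich a a' Y)"
proof (rule T.balanced_linearI)
  have YT: "Y \<in> carrier T" using Y by (simp add: carrier_E)
  note s = bilinear_sandwich[OF YT]
  show "(\<lambda>a. sandwich a a' Y) \<in> linear_maps K A T" if "a' \<in> carrier A" for a'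
    by (rule bilinear_mapD(2)[OF s that])
  show "sandwich a (x \<oplus>\<^bsub>A\<^esub> y) Y = sandwich a x Y \<oplus>\<^bsub>T\<^esub> sandwich a y Y"
    if "a \<in> carrier A" "x \<in> carrier A" "y \<in> carrier A" for a x y
    using that by (simp add: linear_mapsD(2)[OF bilinear_mapD(1)[OF s]])
  fix a b a' assume *: "a \<in> carrier A" "b \<in> B" "a' \<in> carrier A"
  then have "sandwich (a \<otimes>\<^bsub>A\<^esub> b) a' Y = sandwich a a' (sandwich b \<one>\<^bsub>A\<^esub> Y)"
    by (simp add: sandwich_sandwich YT B_closed)
  also have "\<dots> = sandwich a a' (sandwich \<one>\<^bsub>A\<^esub> b Y)"
    using Y * by (simp add: carrier_E)
  also have "\<dots> = sandwich a (b \<otimes>\<^bsub>A\<^esub> a') Y"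
    using * by (simp add: sandwich_sandwich YT B_closed)
  finally show "sandwich (a \<otimes>\<^bsub>A\<^esub> b) a' Y = sandwich a (b \<otimes>\<^bsub>A\<^esub> a') Y" .
qed

lemma mult_T:
  assumes X: "X \<in> carrier T" and Y: "Y \<in> carrier E"
  shows "X \<otimes>\<^bsub>T\<^esub> Y = tensor_lift (add_monoid T) (\<lambda>a a'. sandwich a a' Y) X"
proof -
  let ?G = "tensor_group A A B (\<lambda>a b. a \<otimes>\<^bsub>A\<^esub> b) (\<lambda>b a. b \<otimes>\<^bsub>A\<^esub> a)"
  have YT: "Y \<in> carrier T" using Y by (simp add: carrier_E)
  note bal = balanced_mult[OF Y]
  define I where "I a a' = tensor_lift ?G (\<lambda>x y. t (a \<otimes>\<^bsub>A\<^esub> x) (y \<otimes>\<^bsub>A\<^esub> a')) Y" for a a'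
  have I: "I a a' = sandwich a a' Y" if "a \<in> carrier A" "a' \<in> carrier A" for a a'
    unfolding I_def sandwich_def
    by (rule T.tensor_lift_tensor_group[OF balanced_sandwich[OF that] YT])
  have "X \<otimes>\<^bsub>T\<^esub> Y = tensor_lift ?G I X"
    by (simp add: tensor_over_def Let_def I_def[abs_def])
  also have "\<dots> = tensor_lift (add_monoid T) I X"
    by (rule T.tensor_lift_tensor_group[OF T.balanced_linear_cong[OF bal I] X])
  also have "\<dots> = tensor_lift (add_monoid T) (\<lambda>a a'. sandwich a a' Y) X"
    by (rule T.lift_cong[OF module_T bal X I])
  finally show "X \<otimes>\<^bsub>T\<^esub> Y = tensor_lift (add_monoid T) (\<lambda>a a'. sandwich a a' Y) X" .
qed

end

section \<open>The translation map\<close>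

context hopf_galois_extension
begin

interpretation AH: assoc_algebra K AH by (rule algebra_AH)
interpretation T: balanced_tensor K A A B "\<lambda>a b. a \<otimes>\<^bsub>A\<^esub> b" "\<lambda>b a. b \<otimes>\<^bsub>A\<^esub> a" T t
  by (rule balanced_tensor_over)

abbreviation "can_inv \<equiv> inv_into (carrier T) can"
abbreviation "\<kappa> \<equiv> translation_map K H A \<rho>"

lemma can_inv_linear: "can_inv \<in> linear_maps K AH T"
  by (rule linear_maps_inv_into[OF module_T can_linear canonical_map_bij])

lemma can_inv_can: "X \<in> carrier T \<Longrightarrow> can_inv (can X) = X"
  using canonical_map_bij by (simp add: bij_betw_def inv_into_f_f)

lemma can_can_inv: "Y \<in> carrier AH \<Longrightarrow> can (can_inv Y) = Y"
  using canonical_map_bij by (simp add: bij_betw_def f_inv_into_f)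

lemma can_eqD: "can X = can Y \<Longrightarrow> X \<in> carrier T \<Longrightarrow> Y \<in> carrier T \<Longrightarrow> X = Y"
  using canonical_map_bij by (auto simp: bij_betw_def inj_on_def)

lemma translation_eq: "\<kappa> = (\<lambda>h. can_inv (e \<one>\<^bsub>A\<^esub> h))"
  by (simp add: translation_map_def fun_eq_iff)

lemma translation_linear_T: "\<kappa> \<in> linear_maps K H T"
  unfolding translation_eq
  by (rule linear_maps_compose[OF bilinear_mapD(1)[OF bilinear_e A.one_closed] can_inv_linear])

lemmas translation_closed_T = linear_mapsD(1)[OF translation_linear_T]

lemma can_translation: "h \<in> carrier H \<Longrightarrow> can (\<kappa> h) = e \<one>\<^bsub>A\<^esub> h"
  by (simp add: translation_eq can_can_inv e_closed)

text \<open>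
  Under \<open>can\<close> the two sides \<open>b \<kappa>(h)\<close> and \<open>\<kappa>(h) b\<close> become \<open>(b \<otimes> 1) (1 \<otimes> h)\<close> and
  \<open>(1 \<otimes> h) (b \<otimes> 1)\<close>.
\<close>

lemma translation_closed:
  assumes h: "h \<in> carrier H" shows "\<kappa> h \<in> carrier E"
proof -
  have "sandwich b \<one>\<^bsub>A\<^esub> (\<kappa> h) = sandwich \<one>\<^bsub>A\<^esub> b (\<kappa> h)" if b: "b \<in> B" for b
    using h b
    by (intro can_eqD linear_mapsD(1)[OF sandwich_linear])
       (simp_all add: can_sandwich translation_closed_T can_translation coaction_B coaction_one
         one_AH B_closed e_mult)
  then show ?thesis using h by (simp add: carrier_E translation_closed_T)
qed

lemma translation_linear: "\<kappa> \<in> linear_maps K H E"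
  using translation_linear_T by (auto simp: linear_maps_def translation_closed ops_E)

lemma translation_one: "\<kappa> \<one>\<^bsub>H\<^esub> = \<one>\<^bsub>E\<^esub>"
  unfolding ops_E
  by (rule can_eqD)
     (simp_all add: can_translation translation_closed_T one_T can_t T.t_closed coaction_one
       one_AH e_mult)

lemma can_mult_translation:
  assumes X: "X \<in> carrier T" and k: "k \<in> carrier H"
  shows "can (X \<otimes>\<^bsub>T\<^esub> \<kappa> k) = e \<one>\<^bsub>A\<^esub> k \<otimes>\<^bsub>AH\<^esub> can X"
proof -
  note bal = balanced_mult[OF translation_closed[OF k]]
  have "can (tensor_lift (add_monoid T) (\<lambda>a a'. sandwich a a' (\<kappa> k)) X)
      = e \<one>\<^bsub>A\<^esub> k \<otimes>\<^bsub>AH\<^esub> can X"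
  proof (rule T.linear_maps_eqI[OF linear_maps_compose[OF
        T.lift_linear[OF module_T bal] can_linear]
        linear_maps_compose[OF can_linear linear_map_mult_left[OF algebra_AH]] X])
    fix a a' assume *: "a \<in> carrier A" "a' \<in> carrier A"
    have "e a \<one>\<^bsub>H\<^esub> \<otimes>\<^bsub>AH\<^esub> e \<one>\<^bsub>A\<^esub> k = e \<one>\<^bsub>A\<^esub> k \<otimes>\<^bsub>AH\<^esub> e a \<one>\<^bsub>H\<^esub>"
      using * k by (simp add: e_mult)
    then show "can (tensor_lift (add_monoid T) (\<lambda>a a'. sandwich a a' (\<kappa> k)) (t a a'))
        = e \<one>\<^bsub>A\<^esub> k \<otimes>\<^bsub>AH\<^esub> can (t a a')"
      using * k by (simp add: T.lift_t[OF module_T bal] can_sandwich can_translation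
          translation_closed_T can_t AH.m_assoc e_closed coaction_closed)
  qed (simp add: e_closed k)
  then show ?thesis by (simp add: mult_T[OF X translation_closed[OF k]])
qed

text \<open>Both sides are mapped to \<open>1 \<otimes> k h\<close> by \<open>can\<close>.\<close>

lemma translation_antimult:
  assumes "h \<in> carrier H" "k \<in> carrier H"
  shows "\<kappa> h \<otimes>\<^bsub>E\<^esub> \<kappa> k = \<kappa> (k \<otimes>\<^bsub>H\<^esub> h)"
proof -
  have "\<kappa> h \<otimes>\<^bsub>T\<^esub> \<kappa> k \<in> carrier T"
    unfolding mult_T[OF translation_closed_T[OF assms(1)] translation_closed[OF assms(2)]]
    by (rule linear_mapsD(1)[OF T.lift_linear[OF module_T balanced_mult]])
       (simp_all add: translation_closed_T translation_closed assms)
  then show ?thesis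
    unfolding ops_E
    by (rule can_eqD[rotated])
       (simp_all add: assms can_mult_translation can_translation translation_closed_T e_mult)
qed

lemma comult_closed: "h \<in> carrier H \<Longrightarrow> \<Delta> h \<in> carrier (tensor K H H)"
  by (rule linear_mapsD(1)[OF comult_linear])

lemma bilinear_mult_H: "bilinear_map K H H H (mult H)"
  by (intro bilinear_mapI linear_map_mult_left linear_map_mult_right algebra_H)

text \<open>
  For \<open>(f, g) = (id, S)\<close> and \<open>(S, id)\<close> the last assumption is an antipode axiom, so that both
  convolution identities follow from one argument.
\<close>

lemma translation_convolution:
  assumes H: "cring H"
    and f: "f \<in> linear_maps K H H" and g: "g \<in> linear_maps K H H" and h: "h \<in> carrier H"
    and eq: "tensor_lift (add_monoid H) (\<lambda>x y. f x \<otimes>\<^bsub>H\<^esub> g y) (\<Delta> h) = \<epsilon> h \<odot>\<^bsub>H\<^esub> \<one>\<^bsub>H\<^esub>"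
  shows "convolution \<Delta> E (\<lambda>x. \<kappa> (f x)) (\<lambda>y. \<kappa> (g y)) h = \<epsilon> h \<odot>\<^bsub>E\<^esub> \<one>\<^bsub>E\<^esub>"
proof -
  interpret H: cring H by (rule H)
  note fg = bilinear_map_compose_args[OF bilinear_mult_H f g]
  have mult: "\<kappa> (f x) \<otimes>\<^bsub>E\<^esub> \<kappa> (g y) = \<kappa> (f x \<otimes>\<^bsub>H\<^esub> g y)"
    if "x \<in> carrier H" "y \<in> carrier H" for x y
    using that f g by (simp add: translation_antimult linear_mapsD(1) H.m_comm)
  note b = bilinear_map_compose[OF fg translation_linear]
  have b': "bilinear_map K H H E (\<lambda>x y. \<kappa> (f x) \<otimes>\<^bsub>E\<^esub> \<kappa> (g y))"
    by (intro bilinear_mapI linear_maps_cong[OF bilinear_mapD(1)[OF b] module_H]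
        linear_maps_cong[OF bilinear_mapD(2)[OF b] module_H]) (simp_all add: mult)
  have "convolution \<Delta> E (\<lambda>x. \<kappa> (f x)) (\<lambda>y. \<kappa> (g y)) h
      = tensor_lift (add_monoid E) (\<lambda>x y. \<kappa> (f x \<otimes>\<^bsub>H\<^esub> g y)) (\<Delta> h)"
    unfolding convolution_def
    by (rule tensor_lift_cong[OF module_H module_H module_E b' b comult_closed[OF h] mult])
  also have "\<dots> = \<kappa> (tensor_lift (add_monoid H) (\<lambda>x y. f x \<otimes>\<^bsub>H\<^esub> g y) (\<Delta> h))"
    by (rule linear_map_tensor_lift[OF module_H module_H module_H module_E fg translation_linear
          comult_closed[OF h], symmetric])
  also have "\<dots> = \<epsilon> h \<odot>\<^bsub>E\<^esub> \<one>\<^bsub>E\<^esub>"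
    using h counit_ring_hom
    by (simp add: eq linear_mapsD(3)[OF translation_linear] translation_one ring_hom_def Pi_iff)
  finally show ?thesis .
qed

lemma translation_convolution_invertible:
  assumes "cring H" shows "convolution_invertible K H \<Delta> \<epsilon> E \<kappa>"
  unfolding convolution_invertible_def
proof (intro conjI bexI[of _ "\<lambda>h. \<kappa> (S h)"] ballI)
  fix h assume h: "h \<in> carrier H"
  show "convolution \<Delta> E \<kappa> (\<lambda>h. \<kappa> (S h)) h = \<epsilon> h \<odot>\<^bsub>E\<^esub> \<one>\<^bsub>E\<^esub>"
    by (rule translation_convolution[OF assms linear_maps_id antipode_linear h antipode_right[OF h]])
  show "convolution \<Delta> E (\<lambda>h. \<kappa> (S h)) \<kappa> h = \<epsilon> h \<odot>\<^bsub>E\<^esub> \<one>\<^bsub>E\<^esub>"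
    by (rule translation_convolution[OF assms antipode_linear linear_maps_id h antipode_left[OF h]])
qed (rule translation_linear linear_maps_compose[OF antipode_linear translation_linear])+

section \<open>Colinearity\<close>

abbreviation "eT \<equiv> tensor_elem K T H"

lemmas bilinear_eT = tensor_elem_bilinear[OF module_T module_H]
lemmas module_HH = module_tensor[OF module_H module_H]

text \<open>
  The map \<open>x \<otimes> h \<mapsto> (a \<otimes> x) \<otimes> h\<close>; the coaction of \<open>A \<otimes>\<^sub>B A\<close> is \<open>a \<otimes> a' \<mapsto> attach a \<rho>(a')\<close>.
\<close>

definition attach where
  "attach a = tensor_lift (add_monoid TH) (\<lambda>x h. eT (t a x) h)"

lemma bilinear_attach:
  "a \<in> carrier A \<Longrightarrow> bilinear_map K A H TH (\<lambda>x h. eT (t a x) h)"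
  by (intro bilinear_map_compose_args[OF bilinear_eT] bilinear_mapD(1)[OF bilinear_t] linear_maps_id)

lemma attach_linear: "a \<in> carrier A \<Longrightarrow> attach a \<in> linear_maps K AH TH"
  unfolding attach_def by (rule tensor_lift_linear[OF module_A module_H module_TH bilinear_attach])

lemma attach_elem:
  "a \<in> carrier A \<Longrightarrow> x \<in> carrier A \<Longrightarrow> h \<in> carrier H \<Longrightarrow> attach a (e x h) = eT (t a x) h"
  unfolding attach_def
  by (rule tensor_lift_elem[OF module_A module_H module_TH bilinear_attach])

lemma attach_balanced:
  assumes "a \<in> carrier A" "b \<in> B" "V \<in> carrier AH"
  shows "attach (a \<otimes>\<^bsub>A\<^esub> b) V = attach a (\<rho> b \<otimes>\<^bsub>AH\<^esub> V)"
  by (rule tensor_linear_maps_eqI[OF module_A module_H attach_linear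
        linear_maps_compose[OF linear_map_mult_left[OF algebra_AH] attach_linear]])
     (use assms in \<open>simp_all add: attach_elem coaction_B B_closed e_mult T.t_balanced
        coaction_closed e_closed\<close>)

lemma balanced_coaction: "T.balanced_linear TH (\<lambda>a a'. attach a (\<rho> a'))"
proof (rule T.balanced_linearI)
  fix a' assume a': "a' \<in> carrier A"
  show "(\<lambda>a. attach a (\<rho> a')) \<in> linear_maps K A TH"
    unfolding attach_def
  proof (rule tensor_lift_linear_parameter[OF module_A module_H module_TH module_A
        bilinear_attach _ coaction_closed[OF a']])
    fix x h assume "x \<in> carrier A" "h \<in> carrier H"
    then show "(\<lambda>a. eT (t a x) h) \<in> linear_maps K A TH"
      by (intro linear_maps_compose[OF bilinear_mapD(2)[OF bilinear_t]
          bilinear_mapD(2)[OF bilinear_eT]])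
  qed
next
  fix a b a' assume "a \<in> carrier A" "b \<in> B" "a' \<in> carrier A"
  then show "attach (a \<otimes>\<^bsub>A\<^esub> b) (\<rho> a') = attach a (\<rho> (b \<otimes>\<^bsub>A\<^esub> a'))"
    by (simp add: attach_balanced coaction_closed coaction_mult B_closed)
qed (simp add: linear_mapsD(2)[OF coaction_linear] linear_mapsD(2)[OF attach_linear] coaction_closed)

lemma tensor_over_coaction_eq:
  "tensor_over_coaction K H A \<rho> = tensor_lift (add_monoid TH) (\<lambda>a a'. attach a (\<rho> a'))"
  by (simp add: tensor_over_coaction_def Let_def attach_def)

definition can_inv_left where
  "can_inv_left y = tensor_lift (add_monoid TH) (\<lambda>h k. eT (can_inv (e y h)) k)"

lemma bilinear_can_inv_left_factor:
  assumes "y \<in> carrier A"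
  shows "bilinear_map K H H TH (\<lambda>h k. eT (can_inv (e y h)) k)"
  by (intro bilinear_map_compose_args[OF bilinear_eT _ linear_maps_id]
      linear_maps_compose[OF bilinear_mapD(1)[OF bilinear_e assms] can_inv_linear])

lemma bilinear_can_inv_left: "bilinear_map K A (tensor K H H) TH can_inv_left"
proof (rule bilinear_mapI)
  fix y assume "y \<in> carrier A"
  then show "can_inv_left y \<in> linear_maps K (tensor K H H) TH"
    unfolding can_inv_left_def by (intro tensor_lift_linear[OF module_H module_H module_TH] bilinear_can_inv_left_factor)
next
  fix w assume w: "w \<in> carrier (tensor K H H)"
  show "(\<lambda>y. can_inv_left y w) \<in> linear_maps K A TH"
    unfolding can_inv_left_def
  proof (rule tensor_lift_linear_parameter[OF module_H module_H module_TH module_A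
        bilinear_can_inv_left_factor _ w])
    fix h k assume "h \<in> carrier H" "k \<in> carrier H"
    then show "(\<lambda>y. eT (can_inv (e y h)) k) \<in> linear_maps K A TH"
      by (intro linear_maps_compose[OF linear_maps_compose[OF bilinear_mapD(2)[OF bilinear_e]
            can_inv_linear] bilinear_mapD(2)[OF bilinear_eT]])
  qed
qed

lemma can_inv_left_elem:
  "y \<in> carrier A \<Longrightarrow> h \<in> carrier H \<Longrightarrow> k \<in> carrier H \<Longrightarrow>
    can_inv_left y (tensor_elem K H H h k) = eT (can_inv (e y h)) k"
  unfolding can_inv_left_def by (rule tensor_lift_elem[OF module_H module_H module_TH bilinear_can_inv_left_factor])

text \<open>
  The coaction \<open>id \<otimes> \<Delta>\<close> of \<open>A \<otimes> H\<close>, with \<open>can\<^sup>-\<^sup>1\<close> applied to the \<open>A \<otimes> H\<close>-component of its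
  values: \<open>x \<otimes> h \<mapsto> can\<^sup>-\<^sup>1 (x \<otimes> h\<^sub>1) \<otimes> h\<^sub>2\<close>.
\<close>

abbreviation "galois_coaction \<equiv> tensor_lift (add_monoid TH) (\<lambda>x h. can_inv_left x (\<Delta> h))"

lemma bilinear_galois_coaction: "bilinear_map K A H TH (\<lambda>x h. can_inv_left x (\<Delta> h))"
  by (rule bilinear_map_compose_args[OF bilinear_can_inv_left linear_maps_id comult_linear])

text \<open>
  The left-hand side applies \<open>\<Delta>\<close> to the \<open>H\<close>-component of \<open>a a'\<^sub>0 \<otimes> a'\<^sub>1\<close>.  By coassociativity one
  may apply \<open>\<rho>\<close> to \<open>a'\<^sub>0\<close> instead, and then \<open>can\<^sup>-\<^sup>1\<close> turns \<open>(a \<otimes> 1) \<rho>(a'\<^sub>0)\<close> into \<open>a \<otimes> a'\<^sub>0\<close>.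
  The auxiliary maps \<open>G\<close> and \<open>R\<close> are what remains to be applied after each of the two
  iterated coactions.
\<close>

lemma galois_coaction_can_t:
  assumes a: "a \<in> carrier A" "a' \<in> carrier A"
  shows "galois_coaction (e a \<one>\<^bsub>H\<^esub> \<otimes>\<^bsub>AH\<^esub> \<rho> a') = attach a (\<rho> a')"
proof -
  define G where "G = tensor_lift (add_monoid TH) (\<lambda>x w. can_inv_left (a \<otimes>\<^bsub>A\<^esub> x) w)"
  define R where "R = tensor_lift (add_monoid TH) (\<lambda>Y k. eT (can_inv (e a \<one>\<^bsub>H\<^esub> \<otimes>\<^bsub>AH\<^esub> Y)) k)"
  have ea: "e a \<one>\<^bsub>H\<^esub> \<in> carrier AH" using a by (simp add: e_closed)
  note La = linear_map_mult_left[OF algebra_AH ea]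
  note la = linear_map_mult_left[OF algebra_A a(1)]
  note G = bilinear_map_compose_args[OF bilinear_can_inv_left la linear_maps_id]
  note R = bilinear_map_compose_args[OF bilinear_eT linear_maps_compose[OF La can_inv_linear] linear_maps_id]
  have G_lin: "G \<in> linear_maps K (tensor K A (tensor K H H)) TH"
    unfolding G_def by (rule tensor_lift_linear[OF module_A module_HH module_TH G])
  have R_lin: "R \<in> linear_maps K (tensor K AH H) TH"
    unfolding R_def by (rule tensor_lift_linear[OF module_AH module_H module_TH R])
  have G_elem: "G (tensor_elem K A (tensor K H H) x w) = can_inv_left (a \<otimes>\<^bsub>A\<^esub> x) w"
    if "x \<in> carrier A" "w \<in> carrier (tensor K H H)" for x w
    unfolding G_def using that by (rule tensor_lift_elem[OF module_A module_HH module_TH G])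
  have R_elem: "R (tensor_elem K AH H Y k) = eT (can_inv (e a \<one>\<^bsub>H\<^esub> \<otimes>\<^bsub>AH\<^esub> Y)) k"
    if "Y \<in> carrier AH" "k \<in> carrier H" for Y k
    unfolding R_def using that by (rule tensor_lift_elem[OF module_AH module_H module_TH R])
  note coact = coaction_closed[OF a(2)]
  note rho_id = coaction_linear linear_maps_id[of K H]
  note id_comult = linear_maps_id[of K A] comult_linear
  note asc = tensor_assoc_linear[OF module_A module_H module_H]
    tensor_assoc_elem[OF module_A module_H module_H]
  have "galois_coaction (e a \<one>\<^bsub>H\<^esub> \<otimes>\<^bsub>AH\<^esub> \<rho> a')
      = G (tensor_map K A (tensor K H H) (\<lambda>x. x) \<Delta> (\<rho> a'))"
    by (rule tensor_linear_maps_eqI[OF module_A module_H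
          linear_maps_compose[OF La tensor_lift_linear[OF module_A module_H module_TH bilinear_galois_coaction]]
          linear_maps_compose[OF tensor_map_linear[OF module_A module_H module_A module_HH id_comult] G_lin]
          coact])
       (simp add: e_mult a tensor_lift_elem[OF module_A module_H module_TH bilinear_galois_coaction]
         tensor_map_elem[OF module_A module_H module_A module_HH id_comult] G_elem comult_closed)
  also have "\<dots> = G (tensor_assoc K A H H (tensor_map K AH H \<rho> (\<lambda>x. x) (\<rho> a')))"
    using coaction_coassoc[OF a(2)] by simp
  also have "\<dots> = R (tensor_map K AH H \<rho> (\<lambda>x. x) (\<rho> a'))"
  proof (rule tensor_linear_maps_eqI[OF module_AH module_H linear_maps_compose[OF asc(1) G_lin] R_lin])
    show "tensor_map K AH H \<rho> (\<lambda>x. x) (\<rho> a') \<in> carrier (tensor K AH H)"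
      by (rule linear_mapsD(1)[OF tensor_map_linear[OF module_A module_H module_AH module_H rho_id] coact])
    fix Y k assume Y: "Y \<in> carrier AH" and k: "k \<in> carrier H"
    show "G (tensor_assoc K A H H (tensor_elem K AH H Y k)) = R (tensor_elem K AH H Y k)"
      by (rule tensor_linear_maps_eqI[OF module_A module_H
            linear_maps_compose[OF bilinear_mapD(2)[OF tensor_elem_bilinear[OF module_AH module_H] k]
              linear_maps_compose[OF asc(1) G_lin]]
            linear_maps_compose[OF bilinear_mapD(2)[OF tensor_elem_bilinear[OF module_AH module_H] k]
              R_lin] Y])
         (simp add: asc(2) k G_elem R_elem can_inv_left_elem a e_closed e_mult
           bilinear_mapD(3)[OF tensor_elem_bilinear[OF module_H module_H]])
  qed
  also have "\<dots> = attach a (\<rho> a')"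
    by (rule tensor_linear_maps_eqI[OF module_A module_H
          linear_maps_compose[OF tensor_map_linear[OF module_A module_H module_AH module_H rho_id] R_lin]
          attach_linear[OF a(1)] coact])
       (simp add: tensor_map_elem[OF module_A module_H module_AH module_H rho_id] R_elem
         coaction_closed attach_elem a can_t[symmetric] can_inv_can T.t_closed)
  finally show ?thesis .
qed

lemma tensor_over_coaction_can:
  assumes X: "X \<in> carrier T"
  shows "tensor_over_coaction K H A \<rho> X = galois_coaction (can X)"
  unfolding tensor_over_coaction_eq
  by (rule T.linear_maps_eqI[OF T.lift_linear[OF module_TH balanced_coaction]
        linear_maps_compose[OF can_linear
          tensor_lift_linear[OF module_A module_H module_TH bilinear_galois_coaction]] X])
     (simp add: T.lift_t[OF module_TH balanced_coaction] can_t galois_coaction_can_t)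

lemma tensor_over_coaction_translation:
  assumes h: "h \<in> carrier H"
  shows "tensor_over_coaction K H A \<rho> (\<kappa> h) = tensor_map K T H \<kappa> (\<lambda>x. x) (\<Delta> h)"
  using h by (simp add: tensor_over_coaction_can translation_closed_T can_translation
      tensor_lift_elem[OF module_A module_H module_TH bilinear_galois_coaction])
    (simp add: can_inv_left_def tensor_map_def translation_eq)

text \<open>
  The tensor on the left lies in \<open>E \<otimes> H\<close> and is mapped to the coaction of \<open>\<kappa> h\<close> in
  \<open>(A \<otimes>\<^sub>B A) \<otimes> H\<close>; by injectivity it is the element that defines the coaction of \<open>E\<close>.
\<close>

lemma translation_colinear:
  assumes h: "h \<in> carrier H"
  shows "tensor_map K E H \<kappa> (\<lambda>x. x) (\<Delta> h) = centralizer_coaction K H A \<rho> (\<kappa> h)"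
proof -
  note mHE = module_H module_H module_E module_H translation_linear linear_maps_id[of K H]
  note mHT = module_H module_H module_T module_H translation_linear_T linear_maps_id[of K H]
  have i: "(\<lambda>x. x) \<in> linear_maps K E T"
    by (auto simp: linear_maps_def ops_E carrier_E)
  note mET = module_E module_H module_T module_H i linear_maps_id[of K H]
  let ?U = "tensor_map K E H \<kappa> (\<lambda>x. x) (\<Delta> h)"
  have U: "?U \<in> carrier (tensor K E H)"
    by (rule linear_mapsD(1)[OF tensor_map_linear[OF mHE] comult_closed[OF h]])
  have "tensor_map K T H (\<lambda>x. x) (\<lambda>x. x) ?U = tensor_map K T H \<kappa> (\<lambda>x. x) (\<Delta> h)"
    by (rule tensor_linear_maps_eqI[OF module_H module_H
          linear_maps_compose[OF tensor_map_linear[OF mHE] tensor_map_linear[OF mET]]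
          tensor_map_linear[OF mHT] comult_closed[OF h]])
       (simp add: tensor_map_elem[OF mHE] tensor_map_elem[OF mHT] tensor_map_elem[OF mET]
         translation_closed)
  then have eq: "tensor_map K T H (\<lambda>x. x) (\<lambda>x. x) ?U = tensor_over_coaction K H A \<rho> (\<kappa> h)"
    using tensor_over_coaction_translation[OF h] by simp
  have inj: "inj_on (tensor_map K T H (\<lambda>x. x) (\<lambda>x. x)) (carrier (tensor K E H))"
    using tensor_map_submodule_inj[OF field_axioms module_T module_H submodule_E]
    by (subst (asm) E_eq[symmetric])
  show ?thesis
    unfolding centralizer_coaction_def Let_def
    by (rule the_equality[symmetric]) (use U eq inj in \<open>auto simp: inj_on_def\<close>)
qed

end

theorem proposition3p16:
  fixes K :: "('k, 'l) ring_scheme"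
    and H :: "('k, 'h, 'm) module_scheme"
    and \<Delta> :: "'h \<Rightarrow> ('h \<times> 'h \<Rightarrow>\<^sub>0 int) set" and \<epsilon> :: "'h \<Rightarrow> 'k" and S :: "'h \<Rightarrow> 'h"
    and A :: "('k, 'a, 'n) module_scheme"
    and \<rho> :: "'a \<Rightarrow> ('a \<times> 'h \<Rightarrow>\<^sub>0 int) set"
  assumes "hopf_galois_extension K H \<Delta> \<epsilon> S A \<rho>"
    and "cring H"
  shows "total_integral K H \<Delta> (tensor_centralizer (coinvariants K H A \<rho>) A)
           (centralizer_coaction K H A \<rho>) (translation_map K H A \<rho>)
       \<and> convolution_invertible K H \<Delta> \<epsilon> (tensor_centralizer (coinvariants K H A \<rho>) A)
           (translation_map K H A \<rho>)"
proof -
  interpret hopf_galois_extension K H \<Delta> \<epsilon> S A \<rho> by (rule assms(1))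
  show ?thesis
    unfolding total_integral_def
    using translation_linear translation_one translation_colinear
      translation_convolution_invertible[OF assms(2)] by blast
qed

end
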